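(* Let $0\le u_0\in L^1(\mathbb{R}^N)\cap L^\infty(\mathbb{R}^N)$ with $u_0=0$ in $\mathcal{H}$, let $u$ be the solution of the nonlocal problem with initial datum $u_0$, let $\phi$ be the solution of the stationary problem, and let $M^*=\int_{\mathbb{R}^N}u_0(x)\phi(x)\,dx$. Then the mass $M(t)=\int_{\mathbb{R}^N}u(x,t)\,dx$ of the solution at time $t$ satisfies $M(t)\to M^*$ as $t\to\infty$.
   Context: Setting: $N\ge 3$; $\mathcal{H}\subset\mathbb{R}^N$ is a bounded open set with smooth boundary (not necessarily connected), $0\in\mathcal{H}$, and $\Omega=\mathbb{R}^N\setminus\mathcal{H}$. The kernel $J:\mathbb{R}^N\to[0,\infty)$ is smooth, radially symmetric, compactly supported in the unit ball centered at the origin, with $J(0)>0$ and $\int_{\mathbb{R}^N}J=1$. Nonlocal problem: $\partial_t u(x,t)=\int_{\mathbb{R}^N}J(x-y)(u(y,t)-u(x,t))\,dy$ in $\Omega\times(0,\infty)$, $u=0$ in $\mathcal{H}\times(0,\infty)$, $u(\cdot,0)=u_0$. A solution is a function $u\in C([0,\infty);L^1(\mathbb{R}^N))$ such that for all $t>0$, $u(\cdot,t)=u_0+\int_0^t(J*u(\cdot,s)-u(\cdot,s))\,ds$ a.e. in $\Omega$ and $u(\cdot,t)=0$ a.e. in $\mathcal{H}$; it exists and is unique. Stationary problem: $\phi\in L^1_{\rm loc}(\mathbb{R}^N)$ is the unique solution of $J*\phi=\phi$ in $\Omega$, $\phi=0$ in $\mathcal{H}$, $\phi(x)\to1$ as $|x|\to\infty$.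 *)

theory Defs
  imports "HOL-Analysis.Analysis"
begin

text \<open>
  Elements of \<open>L\<^sup>1\<close> and \<open>L\<^sup>1\<^sub>l\<^sub>o\<^sub>c\<close> are represented by functions, and all statements about
  them are read almost everywhere with respect to Lebesgue measure.
\<close>

primrec Ck_on :: "nat \<Rightarrow> 'a::real_normed_vector set \<Rightarrow> ('a \<Rightarrow> 'b::real_normed_vector) \<Rightarrow> bool" where
  "Ck_on 0 S f \<longleftrightarrow> continuous_on S f"
| "Ck_on (Suc k) S f \<longleftrightarrow>
     (\<forall>x\<in>S. f differentiable (at x)) \<and>
     (\<forall>v. Ck_on k S (\<lambda>x. frechet_derivative f (at x) v))"

definition smooth_on :: "'a::real_normed_vector set \<Rightarrow> ('a \<Rightarrow> 'b::real_normed_vector) \<Rightarrow> bool" where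
  "smooth_on S f \<longleftrightarrow> (\<forall>k. Ck_on k S f)"

text \<open>
  Near each boundary point the set is, in suitable orthonormal coordinates, the region strictly
  above the graph of a smooth function. The unit vector \<open>e\<close> is the direction of the last
  coordinate and \<open>x - (x \<bullet> e) *\<^sub>R e\<close> stands for the other coordinates, so only
  the values of \<open>\<gamma>\<close> on the hyperplane orthogonal to \<open>e\<close> matter.
\<close>

definition smooth_boundary :: "'a::euclidean_space set \<Rightarrow> bool" where
  "smooth_boundary H \<longleftrightarrow>
     (\<forall>p\<in>frontier H. \<exists>r>0. \<exists>e \<gamma>. norm e = 1 \<and> smooth_on UNIV (\<gamma> :: 'a \<Rightarrow> real) \<and>
        H \<inter> ball p r = {x \<in> ball p r. x \<bullet> e > \<gamma> (x - (x \<bullet> e) *\<^sub>R e)})"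

definition dispersal_kernel :: "('a::euclidean_space \<Rightarrow> real) \<Rightarrow> bool" where
  "dispersal_kernel J \<longleftrightarrow>
     (\<forall>x. J x \<ge> 0) \<and>
     smooth_on UNIV J \<and>
     (\<forall>x y. norm x = norm y \<longrightarrow> J x = J y) \<and>
     closure {x. J x \<noteq> 0} \<subseteq> cball 0 1 \<and>
     J 0 > 0 \<and>
     (\<integral>x. J x \<partial>lebesgue) = 1"

definition conv :: "('a::euclidean_space \<Rightarrow> real) \<Rightarrow> ('a \<Rightarrow> real) \<Rightarrow> 'a \<Rightarrow> real" where
  "conv J f x = (\<integral>y. J (x - y) * f y \<partial>lebesgue)"

definition L1_continuous_on :: "real set \<Rightarrow> (real \<Rightarrow> 'a::euclidean_space \<Rightarrow> real) \<Rightarrow> bool" where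
  "L1_continuous_on T u \<longleftrightarrow>
     (\<forall>t\<in>T. integrable lebesgue (u t)) \<and>
     (\<forall>t\<in>T. ((\<lambda>s. \<integral>x. \<bar>u s x - u t x\<bar> \<partial>lebesgue) \<longlongrightarrow> 0) (at t within T))"

text \<open>
  The integral over \<open>[a, b]\<close> of a curve \<open>F\<close> with values in \<open>L\<^sup>1\<close>, as an element \<open>I\<close> of
  \<open>L\<^sup>1\<close>: this is \<^const>\<open>has_integral\<close> on an interval with the \<open>L\<^sup>1\<close> norm in place
  of \<^const>\<open>norm\<close>. For a continuous curve it is the usual (Riemann or Bochner) integral.
  Integrating \<open>F s x\<close> over \<open>s\<close> for fixed \<open>x\<close> instead would depend on
  the choice of the representatives \<open>F s\<close>, which need not be measurable in \<open>s\<close>.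
\<close>

definition has_L1_integral ::
    "(real \<Rightarrow> 'a::euclidean_space \<Rightarrow> real) \<Rightarrow> ('a \<Rightarrow> real) \<Rightarrow> real \<Rightarrow> real \<Rightarrow> bool" where
  "has_L1_integral F I a b \<longleftrightarrow>
     (\<forall>s\<in>{a..b}. integrable lebesgue (F s)) \<and> integrable lebesgue I \<and>
     (\<forall>\<epsilon>>0. \<exists>\<gamma>. gauge \<gamma> \<and>
        (\<forall>D. D tagged_division_of {a..b} \<and> \<gamma> fine D \<longrightarrow>
           (\<integral>x. \<bar>(\<Sum>(s, K)\<in>D. measure lborel K * F s x) - I x\<bar> \<partial>lebesgue) < \<epsilon>))"

definition nonlocal_solution ::
    "('a::euclidean_space \<Rightarrow> real) \<Rightarrow> 'a set \<Rightarrow> ('a \<Rightarrow> real) \<Rightarrow> (real \<Rightarrow> 'a \<Rightarrow> real) \<Rightarrow> bool" where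
  "nonlocal_solution J H u0 u \<longleftrightarrow>
     L1_continuous_on {0..} u \<and>
     (\<forall>t>0.
        (\<exists>I. has_L1_integral (\<lambda>s x. conv J (u s) x - u s x) I 0 t \<and>
             (AE x in lebesgue. x \<in> - H \<longrightarrow> u t x = u0 x + I x)) \<and>
        (AE x in lebesgue. x \<in> H \<longrightarrow> u t x = 0))"

text \<open>
  Intersecting with \<^const>\<open>ae_filter\<close> makes the limit at infinity independent of the
  representative: for every \<open>\<epsilon> > 0\<close> there is \<open>R\<close> such that \<open>\<bar>\<phi> x - 1\<bar> < \<epsilon>\<close> for almost
  every \<open>x\<close> with \<open>norm x \<ge> R\<close>.
\<close>

definition stationary_solution ::
    "('a::euclidean_space \<Rightarrow> real) \<Rightarrow> 'a set \<Rightarrow> ('a \<Rightarrow> real) \<Rightarrow> bool" where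
  "stationary_solution J H \<phi> \<longleftrightarrow>
     (\<forall>K. compact K \<longrightarrow> \<phi> absolutely_integrable_on K) \<and>
     (AE x in lebesgue. x \<in> - H \<longrightarrow> conv J \<phi> x = \<phi> x) \<and>
     (AE x in lebesgue. x \<in> H \<longrightarrow> \<phi> x = 0) \<and>
     (\<phi> \<longlongrightarrow> 1) (inf at_infinity (ae_filter lebesgue))"

end

theory Submission
  imports Defs
begin

text \<open>
  Write \<open>\<langle>u(t), g\<rangle> = \<integral> u(t) g\<close> for a bounded test function \<open>g\<close>. As \<open>J\<close> is even and \<open>u(t)\<close> vanishes
  in the hole \<open>H\<close>, moving the convolution to the other factor turns the equation into
  \<open>\<langle>u(t), g\<rangle>' = \<langle>u(t), Q g - g\<rangle>\<close>, where \<open>Q g = J * (1\<^sub>-\<^sub>H g)\<close>,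
  for \<^emph>\<open>every\<close> bounded measurable \<open>g\<close>. The whole proof consists of choosing \<open>g\<close>.

  \<^item> \<open>g = \<phi>\<close>. The stationary solution is bounded and satisfies \<open>Q \<phi> = \<phi>\<close> outside \<open>H\<close>, so
    \<open>\<langle>u(t), \<phi>\<rangle>\<close> keeps its initial value \<open>M\<^sup>*\<close>. The mass differs from \<open>M\<^sup>*\<close> by
    \<open>\<langle>u(t), 1 - \<phi>\<rangle>\<close>, and \<open>1 - \<phi>\<close> is small far away. Hence it is enough that the total mass stays
    bounded and that the mass in each fixed ball tends to zero.

  \<^item> \<open>0 \<le> g \<le> 1\<close>. Here \<open>(e\<^sup>t \<langle>u(t), g\<rangle>)' = e\<^sup>t \<langle>u(t), Q g\<rangle>\<close>, and \<open>Q\<close> preserves this class of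
    functions. Iterating the integrated identity gives \<open>e\<^sup>t \<langle>u(t), g\<rangle> \<ge> - C t\<^sup>n / n!\<close> for all
    \<open>n\<close>, so \<open>u(t) \<ge> 0\<close> (lemma \<open>u_nonneg\<close>).

  \<^item> \<open>g = 1\<close>. The mass decreases at the rate \<open>\<langle>u(t), J * 1\<^sub>H\<rangle>\<close>, so the mass exposed to absorption
    in one jump is integrable over all times. This \<^emph>\<open>finite occupation\<close> spreads: if it holds for
    the indicator of a ball, the evolution of that indicator transfers it to the convolution of the
    indicator with \<open>J\<close>, which is bounded below by a positive constant on a larger ball. The gain in
    the radius does not depend on the ball, and \<open>H\<close> contains a ball around \<open>0\<close> to start from, so all
    balls have finite occupation (lemma \<open>finite_occupation_ball\<close>).

  \<^item> \<open>g = 1\<^sub>B\<close> for a ball \<open>B\<close>. Since \<open>\<langle>u, g\<rangle>' \<ge> - \<langle>u, g\<rangle>\<close>, the mass in \<open>B\<close> cannot drop quickly. As it is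
    integrable over all times, it has to tend to zero (lemma \<open>pairing_tendsto_0\<close>).

  Compared with a comparison argument against the heat-like decay of the problem in the whole space,
  this uses absorption in the hole itself to empty every ball.
\<close>

section \<open>Bounded test functions and convolution with an even kernel\<close>

lemma sigma_finite_lebesgue: "sigma_finite_measure (lebesgue :: 'a::euclidean_space measure)"
proof
  obtain A :: "'a set set" where "countable A" "A \<subseteq> sets lborel" "\<Union>A = space lborel"
    "\<forall>a\<in>A. emeasure lborel a \<noteq> \<infinity>"
    using lborel.sigma_finite_countable by blast
  then show "\<exists>A::'a set set. countable A \<and> A \<subseteq> sets lebesgue \<and> \<Union>A = space lebesgue \<and>
      (\<forall>a\<in>A. emeasure lebesgue a \<noteq> \<infinity>)"
    by (intro exI[of _ A]) (auto simp: emeasure_completion)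
qed

interpretation lebesgue_pair: pair_sigma_finite
  "lebesgue :: 'a::euclidean_space measure" "lebesgue :: 'a measure"
  by (simp add: pair_sigma_finite_def sigma_finite_lebesgue)

definition test_function :: "('a::euclidean_space \<Rightarrow> real) \<Rightarrow> bool" where
  "test_function g \<longleftrightarrow> g \<in> borel_measurable lebesgue \<and> (\<exists>C. \<forall>x. \<bar>g x\<bar> \<le> C)"

lemma test_functionI:
  "g \<in> borel_measurable lebesgue \<Longrightarrow> (\<And>x. \<bar>g x\<bar> \<le> C) \<Longrightarrow> test_function g"
  by (auto simp: test_function_def)

lemma test_function_measurable: "test_function g \<Longrightarrow> g \<in> borel_measurable lebesgue"
  by (simp add: test_function_def)

lemma test_function_bound:
  assumes "test_function g"
  obtains C where "C > 0" "\<And>x. \<bar>g x\<bar> \<le> C"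
proof -
  obtain C where C: "\<And>x. \<bar>g x\<bar> \<le> C" using assms by (auto simp: test_function_def)
  have "\<bar>g x\<bar> \<le> max C 1" for x using C[of x] by simp
  then show ?thesis using that[of "max C 1"] by simp
qed

lemma test_function_mult:
  assumes "test_function f" "test_function g"
  shows "test_function (\<lambda>x. f x * g x)"
proof -
  obtain C D where "C > 0" "\<And>x. \<bar>f x\<bar> \<le> C" "D > 0" "\<And>x. \<bar>g x\<bar> \<le> D"
    using assms by (metis test_function_bound)
  then show ?thesis
    using assms
    by (intro test_functionI[of _ "C * D"])
       (auto simp: test_function_def abs_mult intro!: mult_mono)
qed

lemma test_function_add:
  assumes "test_function f" "test_function g"
  shows "test_function (\<lambda>x. f x + g x)"
proof -
  obtain C D where "C > 0" "\<And>x. \<bar>f x\<bar> \<le> C" "D > 0" "\<And>x. \<bar>g x\<bar> \<le> D"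
    using assms by (metis test_function_bound)
  then have "\<bar>f x + g x\<bar> \<le> C + D" for x
    by (meson abs_triangle_ineq add_mono order_trans)
  then show ?thesis
    using assms by (intro test_functionI[of _ "C + D"]) (auto simp: test_function_def)
qed

lemma test_function_const: "test_function (\<lambda>x. c)"
  by (intro test_functionI[of _ "\<bar>c\<bar>"]) auto

lemma test_function_cmult: "test_function g \<Longrightarrow> test_function (\<lambda>x. c * g x)"
  using test_function_mult[OF test_function_const] .

lemma test_function_diff:
  "test_function f \<Longrightarrow> test_function g \<Longrightarrow> test_function (\<lambda>x. f x - g x)"
  using test_function_add[of f "\<lambda>x. -1 * g x"] test_function_cmult[of g "-1"] by simp

lemma test_function_indicator: "A \<in> sets lebesgue \<Longrightarrow> test_function (indicator A)"
  by (intro test_functionI[of _ 1]) (auto simp: indicator_def borel_measurable_indicator)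

lemmas test_function_intros =
  test_function_mult test_function_add test_function_const test_function_cmult
  test_function_diff test_function_indicator

lemma integrable_mult_test:
  assumes "integrable lebesgue f" "test_function g"
  shows "integrable lebesgue (\<lambda>x. f x * g x)"
proof -
  obtain C where C: "C > 0" "\<And>x. \<bar>g x\<bar> \<le> C" by (metis test_function_bound assms(2))
  have "integrable lebesgue (\<lambda>x. C * f x)" using assms(1) by simp
  then show ?thesis
  proof (rule Bochner_Integration.integrable_bound)
    show "(\<lambda>x. f x * g x) \<in> borel_measurable lebesgue"
      using assms by (intro borel_measurable_times) (auto simp: test_function_def)
    show "AE x in lebesgue. norm (f x * g x) \<le> norm (C * f x)"
      using C by (auto simp: abs_mult mult.commute[of _ "\<bar>g _\<bar>"] intro!: mult_right_mono)
  qed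
qed

text \<open>
  Finiteness of the total mass is part of the last assumption: the integral of a function that is
  not integrable is \<open>0\<close> by convention.
\<close>

locale symmetric_kernel =
  fixes J :: "'a::euclidean_space \<Rightarrow> real"
  assumes nonneg: "\<And>x. J x \<ge> 0"
    and cont: "continuous_on UNIV J"
    and symmetric: "\<And>x. J (- x) = J x"
    and total_mass: "(\<integral>x. J x \<partial>lebesgue) = 1"
begin

lemma kernel_borel: "J \<in> borel_measurable borel"
  using cont borel_measurable_continuous_onI by blast

lemma kernel_borel_translate: "(\<lambda>x. J (x - y)) \<in> borel_measurable borel"
  using cont by (intro borel_measurable_continuous_onI continuous_intros continuous_on_compose2[OF cont]) auto

lemma has_integral_translate: "has_bochner_integral lebesgue (\<lambda>x. J (x - y)) 1"
proof -
  have "integrable lebesgue J"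
    using total_mass not_integrable_integral_eq[of lebesgue J] by force
  then have J: "integrable lborel J" "(\<integral>x. J x \<partial>lborel) = 1"
    using total_mass kernel_borel by (simp_all add: integrable_completion integral_completion)
  have "distr lborel borel ((+) (- y)) = lborel" by (rule lborel_distr_plus)
  then have "has_bochner_integral (distr lborel borel ((+) (- y))) J 1"
    using J by (simp add: has_bochner_integral_iff)
  then have "has_bochner_integral lborel (\<lambda>x. J (x - y)) 1"
    using kernel_borel by (simp add: has_bochner_integral_iff integrable_distr_eq integral_distr add.commute[of "- y"])
  then show ?thesis
    using kernel_borel_translate[of y]
    by (simp add: has_bochner_integral_iff integrable_completion integral_completion)
qed

lemma symmetric_diff: "J (x - y) = J (y - x)"
  using symmetric[of "x - y"] by simp

lemma has_integral_translate': "has_bochner_integral lebesgue (\<lambda>y. J (x - y)) 1"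
  using has_integral_translate[of x] by (simp add: symmetric_diff)

lemma integrable_translate: "integrable lebesgue (\<lambda>x. J (x - y))" "integrable lebesgue (\<lambda>y. J (x - y))"
  using has_integral_translate has_integral_translate' by (auto simp: has_bochner_integral_iff)

lemma measurable_pair: "(\<lambda>p. J (fst p - snd p)) \<in> borel_measurable (lebesgue \<Otimes>\<^sub>M lebesgue)"
proof -
  have id: "(\<lambda>x. x) \<in> lebesgue \<rightarrow>\<^sub>M (borel :: 'a measure)"
    by (rule measurable_completion) simp
  have "fst \<in> (lebesgue \<Otimes>\<^sub>M lebesgue) \<rightarrow>\<^sub>M (borel :: 'a measure)"
    by (rule measurable_compose[OF measurable_fst id])
  moreover have "snd \<in> (lebesgue \<Otimes>\<^sub>M lebesgue) \<rightarrow>\<^sub>M (borel :: 'a measure)"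
    by (rule measurable_compose[OF measurable_snd id])
  ultimately show ?thesis
    by (intro measurable_compose[OF borel_measurable_diff kernel_borel])
qed

text \<open>
  Joint integrability of \<open>J (x - y) f y g x\<close>, the hypothesis of Fubini's theorem in all that follows:
  integrating in \<open>x\<close> first bounds it by a multiple of \<open>\<bar>f\<bar>\<close>.
\<close>

lemma integrable_pair:
  assumes f: "integrable lebesgue f" and g: "test_function g"
  shows "integrable (lebesgue \<Otimes>\<^sub>M lebesgue) (\<lambda>p. J (fst p - snd p) * f (snd p) * g (fst p))"
proof -
  note [measurable] = measurable_pair borel_measurable_integrable[OF f] test_function_measurable[OF g]
  obtain C where C: "C > 0" "\<And>x. \<bar>g x\<bar> \<le> C" by (metis test_function_bound g)
  have "integrable (lebesgue \<Otimes>\<^sub>M lebesgue) (\<lambda>(y, x). J (x - y) * f y)"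
  proof (rule lebesgue_pair.Fubini_integrable)
    have "(\<lambda>p. J (snd p - fst p) * f (fst p)) \<in> borel_measurable (lebesgue \<Otimes>\<^sub>M lebesgue)"
      using measurable_pair by (subst symmetric_diff) measurable
    then show "(\<lambda>(y, x). J (x - y) * f y) \<in> borel_measurable (lebesgue \<Otimes>\<^sub>M lebesgue)"
      by (simp add: case_prod_beta)
    have "(\<integral>x. norm (J (x - y) * f y) \<partial>lebesgue) = \<bar>f y\<bar>" for y
      using has_integral_translate[of y] nonneg by (simp add: abs_mult has_bochner_integral_iff)
    then show "integrable lebesgue (\<lambda>y. \<integral>x. norm (case (y, x) of (y, x) \<Rightarrow> J (x - y) * f y) \<partial>lebesgue)"
      using f by simp
    show "AE y in lebesgue. integrable lebesgue (\<lambda>x. case (y, x) of (y, x) \<Rightarrow> J (x - y) * f y)"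
      using integrable_translate by auto
  qed
  then have "integrable (lebesgue \<Otimes>\<^sub>M lebesgue) (\<lambda>(x, y). J (x - y) * f y)"
    using lebesgue_pair.integrable_product_swap_iff by fastforce
  then have "integrable (lebesgue \<Otimes>\<^sub>M lebesgue) (\<lambda>p. C * (J (fst p - snd p) * f (snd p)))"
    by (simp add: case_prod_unfold)
  then show ?thesis
  proof (rule Bochner_Integration.integrable_bound)
    show "(\<lambda>p. J (fst p - snd p) * f (snd p) * g (fst p)) \<in> borel_measurable (lebesgue \<Otimes>\<^sub>M lebesgue)"
      by measurable
    show "AE p in lebesgue \<Otimes>\<^sub>M lebesgue.
        norm (J (fst p - snd p) * f (snd p) * g (fst p)) \<le> norm (C * (J (fst p - snd p) * f (snd p)))"
      using C by (auto simp: abs_mult mult.commute[of _ "\<bar>g _\<bar>"] intro!: mult_right_mono)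
  qed
qed

lemma integrable_conv:
  assumes "integrable lebesgue f"
  shows "integrable lebesgue (conv J f)"
  using lebesgue_pair.integrable_fst'[OF integrable_pair[OF assms test_function_const[of 1]]]
  by (simp add: conv_def[abs_def])

text \<open>
  Convolution with an even kernel is its own adjoint for the pairing of \<open>L\<^sup>1\<close> with \<open>L\<^sup>\<infinity>\<close>.
\<close>

lemma conv_duality:
  assumes f: "integrable lebesgue f" and g: "test_function g"
  shows "(\<integral>x. conv J f x * g x \<partial>lebesgue) = (\<integral>y. f y * conv J g y \<partial>lebesgue)"
proof -
  have "(\<integral>y. (\<integral>x. J (x - y) * f y * g x \<partial>lebesgue) \<partial>lebesgue) = (\<integral>x. (\<integral>y. J (x - y) * f y * g x \<partial>lebesgue) \<partial>lebesgue)"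
    using lebesgue_pair.Fubini_integral[of "\<lambda>x y. J (x - y) * f y * g x"] integrable_pair[OF assms]
    by (simp add: case_prod_unfold)
  moreover have "(\<integral>x. J (x - y) * f y * g x \<partial>lebesgue) = f y * conv J g y" for y
  proof -
    have "(\<integral>x. J (x - y) * f y * g x \<partial>lebesgue) = (\<integral>x. f y * (J (y - x) * g x) \<partial>lebesgue)"
      by (intro Bochner_Integration.integral_cong) (simp_all add: symmetric_diff[of _ y])
    then show ?thesis by (simp add: conv_def)
  qed
  ultimately show ?thesis by (simp add: conv_def)
qed

lemma integrable_conv_integrand:
  assumes "test_function g"
  shows "integrable lebesgue (\<lambda>y. J (x - y) * g y)"
  using integrable_mult_test[OF integrable_translate(2) assms] .

lemma conv_mono:
  assumes "test_function f" "test_function g" "\<And>x. f x \<le> g x"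
  shows "conv J f x \<le> conv J g x"
  unfolding conv_def
  using assms nonneg by (intro integral_mono integrable_conv_integrand mult_left_mono)

lemma conv_const: "conv J (\<lambda>x. c) x = c"
  using has_integral_translate'[of x] by (simp add: conv_def has_bochner_integral_iff)

lemma conv_add:
  assumes "test_function f" "test_function g"
  shows "conv J (\<lambda>x. f x + g x) x = conv J f x + conv J g x"
  using integrable_conv_integrand[OF assms(1)] integrable_conv_integrand[OF assms(2)]
  by (simp add: conv_def distrib_left)

lemma test_function_conv:
  assumes g: "test_function g"
  shows "test_function (conv J g)"
proof -
  obtain C where C: "C > 0" "\<And>x. \<bar>g x\<bar> \<le> C" by (metis test_function_bound g)
  show ?thesis
  proof (rule test_functionI)
    note [measurable] = measurable_pair test_function_measurable[OF g]
    have "(\<lambda>p. J (fst p - snd p) * g (snd p)) \<in> borel_measurable (lebesgue \<Otimes>\<^sub>M lebesgue)"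
      by measurable
    then show "conv J g \<in> borel_measurable lebesgue"
      unfolding conv_def[abs_def]
      by (intro sigma_finite_measure.borel_measurable_lebesgue_integral[OF sigma_finite_lebesgue])
         (simp add: case_prod_beta)
    have "- C \<le> g x" "g x \<le> C" for x using C(2)[of x] by auto
    then show "\<bar>conv J g x\<bar> \<le> C" for x
      using conv_mono[OF test_function_const g, of "- C" x] conv_mono[OF g test_function_const, of C x]
      by (auto simp: conv_const)
  qed
qed

end

section \<open>The evolution tested against a bounded function\<close>

text \<open>
  Integration against \<open>g\<close> is a bounded linear functional on \<open>L\<^sup>1\<close>, so it commutes with Riemann sums and
  their limits. This turns the \<open>L\<^sup>1\<close>-valued equation into scalar ones.
\<close>

lemma has_L1_integral_pairing:
  assumes F: "has_L1_integral F I a b" and g: "test_function g"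
  shows "((\<lambda>s. \<integral>x. F s x * g x \<partial>lebesgue) has_integral (\<integral>x. I x * g x \<partial>lebesgue)) {a..b}"
  unfolding has_integral_real
proof (intro allI impI)
  fix e :: real
  assume "e > 0"
  obtain C where C: "C > 0" "\<And>x. \<bar>g x\<bar> \<le> C" by (metis test_function_bound g)
  have F_int: "\<And>s. s \<in> {a..b} \<Longrightarrow> integrable lebesgue (F s)" and I_int: "integrable lebesgue I"
    using F by (auto simp: has_L1_integral_def)
  have "e / C > 0" using \<open>e > 0\<close> C by simp
  then obtain \<gamma> where "gauge \<gamma>" and \<gamma>: "\<And>D. D tagged_division_of {a..b} \<Longrightarrow> \<gamma> fine D \<Longrightarrow>
      (\<integral>x. \<bar>(\<Sum>(s, K)\<in>D. measure lborel K * F s x) - I x\<bar> \<partial>lebesgue) < e / C"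
    using F unfolding has_L1_integral_def by meson
  show "\<exists>\<gamma>. gauge \<gamma> \<and> (\<forall>D. D tagged_division_of {a..b} \<and> \<gamma> fine D \<longrightarrow>
      norm ((\<Sum>(s, K)\<in>D. measure lborel K *\<^sub>R (\<integral>x. F s x * g x \<partial>lebesgue)) - (\<integral>x. I x * g x \<partial>lebesgue)) < e)"
  proof (intro exI conjI allI impI)
    show "gauge \<gamma>" by fact
  next
    fix D
    assume "D tagged_division_of {a..b} \<and> \<gamma> fine D"
    then have D: "D tagged_division_of {a..b}" "\<gamma> fine D" by auto
    define S where "S x = (\<Sum>(s, K)\<in>D. measure lborel K * F s x)" for x
    have F_D: "integrable lebesgue (F (fst p))" if "p \<in> D" for p
      using that tagged_division_ofD(2,3)[OF D(1), of "fst p" "snd p"]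
      by (intro F_int) (auto simp del: atLeastAtMost_iff)
    have S_int: "integrable lebesgue S"
      unfolding S_def[abs_def] using F_D by (auto simp: case_prod_unfold)
    have "(\<integral>x. S x * g x \<partial>lebesgue) =
        (\<integral>x. (\<Sum>p\<in>D. measure lborel (snd p) * (F (fst p) x * g x)) \<partial>lebesgue)"
      by (simp add: S_def case_prod_unfold sum_distrib_right mult.assoc)
    also have "\<dots> = (\<Sum>p\<in>D. \<integral>x. measure lborel (snd p) * (F (fst p) x * g x) \<partial>lebesgue)"
      using integrable_mult_test[OF F_D g]
      by (intro Bochner_Integration.integral_sum integrable_mult_right)
    also have "\<dots> = (\<Sum>(s, K)\<in>D. measure lborel K *\<^sub>R (\<integral>x. F s x * g x \<partial>lebesgue))"
      by (simp add: case_prod_unfold)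
    finally have "(\<Sum>(s, K)\<in>D. measure lborel K *\<^sub>R (\<integral>x. F s x * g x \<partial>lebesgue)) - (\<integral>x. I x * g x \<partial>lebesgue)
        = (\<integral>x. S x * g x \<partial>lebesgue) - (\<integral>x. I x * g x \<partial>lebesgue)" by simp
    also have "\<dots> = (\<integral>x. (S x - I x) * g x \<partial>lebesgue)"
      using integrable_mult_test[OF S_int g] integrable_mult_test[OF I_int g]
      by (simp add: left_diff_distrib)
    also have "\<bar>\<dots>\<bar> \<le> (\<integral>x. C * \<bar>S x - I x\<bar> \<partial>lebesgue)"
    proof (rule integral_abs_bound_integral)
      show "integrable lebesgue (\<lambda>x. (S x - I x) * g x)"
        using S_int I_int by (intro integrable_mult_test g) auto
      show "integrable lebesgue (\<lambda>x. C * \<bar>S x - I x\<bar>)" using S_int I_int by auto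
      show "\<bar>(S x - I x) * g x\<bar> \<le> C * \<bar>S x - I x\<bar>" for x
        using C(2)[of x] by (simp add: abs_mult mult.commute[of C] mult_left_mono)
    qed
    also have "\<dots> = C * (\<integral>x. \<bar>S x - I x\<bar> \<partial>lebesgue)" by simp
    also have "\<dots> < e" using \<gamma>[OF D] C by (simp add: S_def field_simps)
    finally show "norm ((\<Sum>(s, K)\<in>D. measure lborel K *\<^sub>R (\<integral>x. F s x * g x \<partial>lebesgue)) -
        (\<integral>x. I x * g x \<partial>lebesgue)) < e" by simp
  qed
qed

locale nonlocal_diffusion = symmetric_kernel J for J :: "'a::euclidean_space \<Rightarrow> real" +
  fixes H :: "'a set" and u0 :: "'a \<Rightarrow> real" and u :: "real \<Rightarrow> 'a \<Rightarrow> real"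
  assumes H_measurable: "H \<in> sets lebesgue"
    and u0_integrable: "integrable lebesgue u0"
    and u0_nonneg: "AE x in lebesgue. u0 x \<ge> 0"
    and u0_zero: "AE x in lebesgue. x \<in> H \<longrightarrow> u0 x = 0"
    and solution: "nonlocal_solution J H u0 u"
begin

definition pairing :: "real \<Rightarrow> ('a \<Rightarrow> real) \<Rightarrow> real" where
  "pairing t g = (\<integral>x. u t x * g x \<partial>lebesgue)"

definition cut :: "('a \<Rightarrow> real) \<Rightarrow> 'a \<Rightarrow> real" where
  "cut g = (\<lambda>x. indicator (- H) x * g x)"

text \<open>
  The adjoint of one jump of the process that dies on entering \<open>H\<close>: \<open>Q g x\<close> is the expected value of
  \<open>g\<close> after a jump from \<open>x\<close>, counted as \<open>0\<close> if the jump ends in \<open>H\<close>.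
\<close>

definition Q :: "('a \<Rightarrow> real) \<Rightarrow> 'a \<Rightarrow> real" where
  "Q g = conv J (cut g)"

lemma test_function_cut: "test_function g \<Longrightarrow> test_function (cut g)"
  unfolding cut_def
  by (intro test_function_mult test_function_indicator)
     (use sets.compl_sets[OF H_measurable] in \<open>simp_all add: Compl_eq_Diff_UNIV\<close>)

lemma test_function_Q: "test_function g \<Longrightarrow> test_function (Q g)"
  by (simp add: Q_def test_function_conv test_function_cut)

lemma u_integrable: "t \<ge> 0 \<Longrightarrow> integrable lebesgue (u t)"
  using solution by (auto simp: nonlocal_solution_def L1_continuous_on_def)

lemma integral_cut:
  assumes "f \<in> borel_measurable lebesgue" "test_function g" "AE x in lebesgue. x \<in> H \<longrightarrow> f x = 0"
  shows "(\<integral>x. f x * cut g x \<partial>lebesgue) = (\<integral>x. f x * g x \<partial>lebesgue)"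
proof (rule integral_cong_AE)
  show "AE x in lebesgue. f x * cut g x = f x * g x"
    using assms(3) by eventually_elim (auto simp: cut_def indicator_def)
qed (use assms test_function_cut[OF assms(2)] in \<open>auto simp: test_function_def\<close>)

lemma L1_distance_tendsto_0:
  "t \<ge> 0 \<Longrightarrow> ((\<lambda>s. \<integral>x. \<bar>u s x - u t x\<bar> \<partial>lebesgue) \<longlongrightarrow> 0) (at t within {0..})"
  using solution by (auto simp: nonlocal_solution_def L1_continuous_on_def)

lemma continuous_on_pairing:
  assumes g: "test_function g"
  shows "continuous_on {0..} (\<lambda>t. pairing t g)"
  unfolding continuous_on_def
proof
  fix t :: real
  assume t: "t \<in> {0..}"
  obtain C where C: "C > 0" "\<And>x. \<bar>g x\<bar> \<le> C" by (metis test_function_bound g)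
  have "((\<lambda>s. C * (\<integral>x. \<bar>u s x - u t x\<bar> \<partial>lebesgue)) \<longlongrightarrow> C * 0) (at t within {0..})"
    using L1_distance_tendsto_0 t by (intro tendsto_mult_left) auto
  then have lim: "((\<lambda>s. C * (\<integral>x. \<bar>u s x - u t x\<bar> \<partial>lebesgue)) \<longlongrightarrow> 0) (at t within {0..})" by simp
  have "\<bar>pairing s g - pairing t g\<bar> \<le> C * (\<integral>x. \<bar>u s x - u t x\<bar> \<partial>lebesgue)" if "s \<ge> 0" for s
  proof -
    have ints: "integrable lebesgue (u s)" "integrable lebesgue (u t)"
      using u_integrable that t by auto
    have "pairing s g - pairing t g = (\<integral>x. (u s x - u t x) * g x \<partial>lebesgue)"
      using ints[THEN integrable_mult_test, OF g] by (simp add: pairing_def left_diff_distrib)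
    also have "\<bar>\<dots>\<bar> \<le> (\<integral>x. C * \<bar>u s x - u t x\<bar> \<partial>lebesgue)"
    proof (rule integral_abs_bound_integral)
      show "integrable lebesgue (\<lambda>x. (u s x - u t x) * g x)"
        using ints by (intro integrable_mult_test g) auto
      show "integrable lebesgue (\<lambda>x. C * \<bar>u s x - u t x\<bar>)" using ints by auto
      show "\<bar>(u s x - u t x) * g x\<bar> \<le> C * \<bar>u s x - u t x\<bar>" for x
        using C(2)[of x] by (simp add: abs_mult mult.commute[of C] mult_left_mono)
    qed
    finally show ?thesis by simp
  qed
  then have "\<forall>\<^sub>F s in at t within {0..}.
      norm (pairing s g - pairing t g) \<le> C * (\<integral>x. \<bar>u s x - u t x\<bar> \<partial>lebesgue)"
    by (auto simp: eventually_at_filter)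
  from Lim_null_comparison[OF this lim]
  show "((\<lambda>s. pairing s g) \<longlongrightarrow> pairing t g) (at t within {0..})"
    by (rule LIM_zero_cancel)
qed

lemma L1_norm_bounded: obtains C where "C \<ge> 0" "\<And>t. t \<in> {0..T} \<Longrightarrow> (\<integral>x. \<bar>u t x\<bar> \<partial>lebesgue) \<le> C"
proof -
  have "continuous_on {0..} (\<lambda>t. \<integral>x. \<bar>u t x\<bar> \<partial>lebesgue)"
    unfolding continuous_on_def
  proof
    fix t :: real
    assume t: "t \<in> {0..}"
    have "\<bar>(\<integral>x. \<bar>u s x\<bar> \<partial>lebesgue) - (\<integral>x. \<bar>u t x\<bar> \<partial>lebesgue)\<bar> \<le> (\<integral>x. \<bar>u s x - u t x\<bar> \<partial>lebesgue)"
      if "s \<ge> 0" for s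
    proof -
      have ints: "integrable lebesgue (u s)" "integrable lebesgue (u t)"
        using u_integrable that t by auto
      have "(\<integral>x. \<bar>u s x\<bar> \<partial>lebesgue) - (\<integral>x. \<bar>u t x\<bar> \<partial>lebesgue) = (\<integral>x. \<bar>u s x\<bar> - \<bar>u t x\<bar> \<partial>lebesgue)"
        using ints by simp
      also have "\<bar>\<dots>\<bar> \<le> (\<integral>x. \<bar>u s x - u t x\<bar> \<partial>lebesgue)"
        using ints by (intro integral_abs_bound_integral) auto
      finally show ?thesis .
    qed
    then have "\<forall>\<^sub>F s in at t within {0..}.
        norm ((\<integral>x. \<bar>u s x\<bar> \<partial>lebesgue) - (\<integral>x. \<bar>u t x\<bar> \<partial>lebesgue)) \<le> (\<integral>x. \<bar>u s x - u t x\<bar> \<partial>lebesgue)"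
      by (auto simp: eventually_at_filter)
    moreover have "((\<lambda>s. \<integral>x. \<bar>u s x - u t x\<bar> \<partial>lebesgue) \<longlongrightarrow> 0) (at t within {0..})"
      using t by (simp add: L1_distance_tendsto_0)
    ultimately have "((\<lambda>s. (\<integral>x. \<bar>u s x\<bar> \<partial>lebesgue) - (\<integral>x. \<bar>u t x\<bar> \<partial>lebesgue)) \<longlongrightarrow> 0) (at t within {0..})"
      by (rule Lim_null_comparison)
    then show "((\<lambda>s. \<integral>x. \<bar>u s x\<bar> \<partial>lebesgue) \<longlongrightarrow> (\<integral>x. \<bar>u t x\<bar> \<partial>lebesgue)) (at t within {0..})"
      by (rule LIM_zero_cancel)
  qed
  then have "continuous_on {0..T} (\<lambda>t. \<integral>x. \<bar>u t x\<bar> \<partial>lebesgue)"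
    by (rule continuous_on_subset) auto
  then have "compact ((\<lambda>t. \<integral>x. \<bar>u t x\<bar> \<partial>lebesgue) ` {0..T})"
    by (rule compact_continuous_image) simp
  from compact_imp_bounded[OF this]
  obtain C where C: "\<And>t. t \<in> {0..T} \<Longrightarrow> \<bar>\<integral>x. \<bar>u t x\<bar> \<partial>lebesgue\<bar> \<le> C"
    unfolding bounded_iff by (auto simp del: atLeastAtMost_iff)
  show ?thesis
  proof
    show "max C 0 \<ge> 0" by simp
    show "(\<integral>x. \<bar>u t x\<bar> \<partial>lebesgue) \<le> max C 0" if "t \<in> {0..T}" for t
      using C[OF that] by linarith
  qed
qed

lemma pairing_add:
  assumes "t \<ge> 0" "test_function f" "test_function g"
  shows "pairing t (\<lambda>x. f x + g x) = pairing t f + pairing t g"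
  using integrable_mult_test[OF u_integrable[OF assms(1)]] assms
  by (simp add: pairing_def distrib_left)

lemma pairing_cmult: "pairing t (\<lambda>x. c * g x) = c * pairing t g"
  by (simp add: pairing_def mult.left_commute[of _ c])

lemma pairing_diff:
  assumes "t \<ge> 0" "test_function f" "test_function g"
  shows "pairing t (\<lambda>x. f x - g x) = pairing t f - pairing t g"
  using integrable_mult_test[OF u_integrable[OF assms(1)]] assms
  by (simp add: pairing_def right_diff_distrib)

text \<open>
  The equation and the condition in \<open>H\<close> are imposed for positive times only, so it is not yet known
  that \<open>u s\<close> vanishes in \<open>H\<close> at \<open>s = 0\<close>. Hence the truncated function \<open>cut g\<close> in the integrand, which
  is replaced by \<open>g\<close> once the initial value has been identified.
\<close>

lemma weak_formulation_cut:
  assumes t: "t > 0" and g: "test_function g"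
  shows "((\<lambda>s. pairing s (Q g) - pairing s (cut g)) has_integral
      (pairing t g - (\<integral>x. u0 x * g x \<partial>lebesgue))) {0..t}"
proof -
  note cut = test_function_cut[OF g]
  obtain I where I: "has_L1_integral (\<lambda>s x. conv J (u s) x - u s x) I 0 t"
    and eq: "AE x in lebesgue. x \<in> - H \<longrightarrow> u t x = u0 x + I x"
    and zero: "AE x in lebesgue. x \<in> H \<longrightarrow> u t x = 0"
    using solution t by (auto simp: nonlocal_solution_def)
  have I_int: "integrable lebesgue I" using I by (simp add: has_L1_integral_def)
  have ut: "integrable lebesgue (u t)" using u_integrable t by simp
  have "pairing t g = (\<integral>x. u t x * cut g x \<partial>lebesgue)"
    using integral_cut[OF _ g zero] ut by (simp add: pairing_def)
  also have "\<dots> = (\<integral>x. (u0 x + I x) * cut g x \<partial>lebesgue)"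
  proof (rule integral_cong_AE)
    show "AE x in lebesgue. u t x * cut g x = (u0 x + I x) * cut g x"
      using eq by eventually_elim (auto simp: cut_def indicator_def)
  qed (use ut u0_integrable I_int cut in \<open>auto simp: test_function_def\<close>)
  also have "\<dots> = (\<integral>x. u0 x * cut g x \<partial>lebesgue) + (\<integral>x. I x * cut g x \<partial>lebesgue)"
    using integrable_mult_test[OF u0_integrable cut] integrable_mult_test[OF I_int cut]
    by (simp add: distrib_right)
  also have "(\<integral>x. u0 x * cut g x \<partial>lebesgue) = (\<integral>x. u0 x * g x \<partial>lebesgue)"
    using integral_cut[OF _ g u0_zero] u0_integrable by simp
  finally have total: "(\<integral>x. I x * cut g x \<partial>lebesgue) = pairing t g - (\<integral>x. u0 x * g x \<partial>lebesgue)" by simp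
  have rate: "(\<integral>x. (conv J (u s) x - u s x) * cut g x \<partial>lebesgue) =
      pairing s (Q g) - pairing s (cut g)" if "s \<in> {0..t}" for s
  proof -
    have us: "integrable lebesgue (u s)" using that u_integrable by simp
    have "(\<integral>x. (conv J (u s) x - u s x) * cut g x \<partial>lebesgue) =
        (\<integral>x. conv J (u s) x * cut g x \<partial>lebesgue) - (\<integral>x. u s x * cut g x \<partial>lebesgue)"
      using integrable_mult_test[OF integrable_conv[OF us] cut] integrable_mult_test[OF us cut]
      by (simp add: left_diff_distrib)
    then show ?thesis
      using conv_duality[OF us cut] by (simp add: pairing_def Q_def)
  qed
  show ?thesis
    using has_integral_eq[OF rate has_L1_integral_pairing[OF I cut]] by (simp only: total)
qed

lemma continuous_on_rate:
  assumes "test_function f" "test_function g"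
  shows "continuous_on {0..} (\<lambda>s. pairing s f - pairing s g)"
  by (intro continuous_intros continuous_on_pairing assms)

text \<open>
  The initial value is attained by continuity: both sides of the weak formulation are continuous in
  \<open>t\<close>, and its integral vanishes as \<open>t\<close> decreases to \<open>0\<close>.
\<close>

lemma pairing_at_0:
  assumes g: "test_function g"
  shows "pairing 0 g = (\<integral>x. u0 x * g x \<partial>lebesgue)"
proof -
  define k where "k s = pairing s (Q g) - pairing s (cut g)" for s
  let ?N = "\<integral>x. u0 x * g x \<partial>lebesgue"
  let ?F = "at (0::real) within {0..1}"
  have "continuous_on {0..1} k"
    unfolding k_def using g
    by (intro continuous_on_subset[OF continuous_on_rate] test_function_Q test_function_cut) auto
  then have "continuous_on {0..1} (\<lambda>t. integral {0..t} k)"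
    by (intro indefinite_integral_continuous_1 integrable_continuous_real)
  then have "((\<lambda>t. integral {0..t} k) \<longlongrightarrow> integral {0..0} k) ?F"
    unfolding continuous_on_def by fastforce
  then have "((\<lambda>t. ?N + integral {0..t} k) \<longlongrightarrow> ?N + integral {0..0} k) ?F"
    by (intro tendsto_intros)
  then have lim: "((\<lambda>t. ?N + integral {0..t} k) \<longlongrightarrow> ?N) ?F" by simp
  have eq: "?N + integral {0..t} k = pairing t g" if "t > 0" for t
    using integral_unique[OF weak_formulation_cut[OF that g]] by (simp add: k_def[abs_def])
  have "\<forall>\<^sub>F t in ?F. ?N + integral {0..t} k = pairing t g"
    unfolding eventually_at by (rule exI[of _ 1]) (use eq in force)
  with lim have "((\<lambda>t. pairing t g) \<longlongrightarrow> ?N) ?F"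
    by (rule Lim_transform_eventually)
  moreover have "((\<lambda>t. pairing t g) \<longlongrightarrow> pairing 0 g) ?F"
    using continuous_on_subset[OF continuous_on_pairing[OF g], of "{0..1}"]
    by (auto simp: continuous_on_def)
  moreover have "?F \<noteq> bot" by (simp add: trivial_limit_within islimpt_Icc)
  ultimately show ?thesis by (metis tendsto_unique)
qed

lemma pairing_cut:
  assumes "t \<ge> 0" and g: "test_function g"
  shows "pairing t (cut g) = pairing t g"
proof (cases "t = 0")
  case True
  then show ?thesis
    using integral_cut[OF _ g u0_zero] u0_integrable
    by (simp add: pairing_at_0 test_function_cut g)
next
  case False
  then have "AE x in lebesgue. x \<in> H \<longrightarrow> u t x = 0"
    using solution assms(1) by (auto simp: nonlocal_solution_def)
  then show ?thesis
    using integral_cut[OF _ g] u_integrable[OF assms(1)] by (simp add: pairing_def)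
qed

lemma pairing_derivative:
  assumes g: "test_function g" and t: "t \<in> {0..T}"
  shows "((\<lambda>t. pairing t g) has_real_derivative pairing t (Q g) - pairing t g) (at t within {0..T})"
proof -
  define k where "k s = pairing s (Q g) - pairing s (cut g)" for s
  have "continuous_on {0..T} k"
    unfolding k_def using g
    by (intro continuous_on_subset[OF continuous_on_rate] test_function_Q test_function_cut) auto
  from integral_has_real_derivative[OF this t]
  have deriv: "((\<lambda>t. pairing 0 g + integral {0..t} k) has_real_derivative k t) (at t within {0..T})"
    by (auto intro!: derivative_eq_intros)
  have eq: "pairing 0 g + integral {0..s} k = pairing s g" if "s \<in> {0..T}" for s
  proof (cases "s = 0")
    case False
    then have "s > 0" using that by simp
    from integral_unique[OF weak_formulation_cut[OF this g]] show ?thesis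
      by (simp add: k_def[abs_def] pairing_at_0 g)
  qed simp
  have "((\<lambda>t. pairing t g) has_real_derivative k t) (at t within {0..T})"
    by (rule has_field_derivative_transform_within[OF deriv zero_less_one t eq])
  then show ?thesis using t g by (simp add: k_def pairing_cut)
qed

lemma evolution:
  assumes g: "test_function g" and ab: "0 \<le> a" "a \<le> b"
  shows "((\<lambda>s. pairing s (Q g) - pairing s g) has_integral (pairing b g - pairing a g)) {a..b}"
proof (rule fundamental_theorem_of_calculus[OF ab(2)])
  fix s
  assume "s \<in> {a..b}"
  then have "((\<lambda>t. pairing t g) has_real_derivative pairing s (Q g) - pairing s g) (at s within {0..b})"
    using pairing_derivative[OF g, of s b] ab by simp
  then have "((\<lambda>t. pairing t g) has_real_derivative pairing s (Q g) - pairing s g) (at s within {a..b})"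
    by (rule DERIV_subset) (use ab in auto)
  then show "((\<lambda>t. pairing t g) has_vector_derivative pairing s (Q g) - pairing s g) (at s within {a..b})"
    by (simp add: has_real_derivative_iff_has_vector_derivative)
qed

text \<open>
  The factor \<open>exp s\<close> absorbs the loss term \<open>- \<langle>u, g\<rangle>\<close> of the evolution and leaves only the
  positivity-preserving operator \<open>Q\<close>.
\<close>

lemma exp_evolution:
  assumes g: "test_function g" and t: "0 \<le> t"
  shows "((\<lambda>s. exp s * pairing s (Q g)) has_integral (exp t * pairing t g - pairing 0 g)) {0..t}"
proof -
  have "((\<lambda>s. exp s * pairing s (Q g)) has_integral (exp t * pairing t g - exp 0 * pairing 0 g)) {0..t}"
  proof (rule fundamental_theorem_of_calculus[OF t])
    fix s
    assume "s \<in> {0..t}"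
    then show "((\<lambda>t. exp t * pairing t g) has_vector_derivative exp s * pairing s (Q g)) (at s within {0..t})"
      unfolding has_real_derivative_iff_has_vector_derivative[symmetric]
      by (auto intro!: derivative_eq_intros pairing_derivative[OF g] simp: algebra_simps)
  qed
  then show ?thesis by simp
qed

section \<open>Positivity\<close>

lemma Q_mono:
  assumes "test_function f" "test_function g" "\<And>x. f x \<le> g x"
  shows "Q f x \<le> Q g x"
  unfolding Q_def using assms
  by (intro conv_mono test_function_cut) (auto simp: cut_def indicator_def)

lemma Q_nonneg:
  assumes "test_function g" "\<And>x. 0 \<le> g x"
  shows "0 \<le> Q g x"
  using Q_mono[OF test_function_const[of 0] assms(1), of x] assms(2) conv_const[of 0 x]
  by (simp add: Q_def cut_def)

lemma Q_le_1:
  assumes "test_function g" "\<And>x. g x \<le> 1"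
  shows "Q g x \<le> 1"
proof -
  have "Q g x \<le> conv J (\<lambda>x. 1) x"
    unfolding Q_def using assms
    by (intro conv_mono test_function_cut test_function_const) (auto simp: cut_def indicator_def)
  then show ?thesis by (simp add: conv_const)
qed

lemma pairing_0_nonneg:
  assumes "test_function g" "\<And>x. 0 \<le> g x"
  shows "0 \<le> pairing 0 g"
proof -
  have "AE x in lebesgue. 0 \<le> u0 x * g x"
    using u0_nonneg by eventually_elim (simp add: assms)
  then show ?thesis using assms by (simp add: pairing_at_0 integral_nonneg_AE)
qed

text \<open>
  Each use of \<open>exp_evolution\<close> replaces \<open>g\<close> by \<open>Q g\<close>, which is again between \<open>0\<close> and \<open>1\<close>, and
  integrates the previous lower bound once in time. The initial term is nonnegative and can be
  dropped.
\<close>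

lemma pairing_lower_bound:
  assumes C: "\<And>t. t \<in> {0..T} \<Longrightarrow> exp t * (\<integral>x. \<bar>u t x\<bar> \<partial>lebesgue) \<le> C"
    and "test_function g" "\<And>x. 0 \<le> g x" "\<And>x. g x \<le> 1" "t \<in> {0..T}"
  shows "- (C * t ^ n / fact n) \<le> exp t * pairing t g"
  using assms(2-)
proof (induction n arbitrary: t g)
  case 0
  have ut: "integrable lebesgue (u t)" using u_integrable 0 by simp
  have "\<bar>pairing t g\<bar> \<le> (\<integral>x. \<bar>u t x\<bar> \<partial>lebesgue)"
    unfolding pairing_def using 0
    by (intro integral_abs_bound_integral integrable_mult_test ut integrable_abs)
      (auto simp: abs_mult mult_left_le)
  then have "exp t * - pairing t g \<le> exp t * (\<integral>x. \<bar>u t x\<bar> \<partial>lebesgue)"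
    by (intro mult_left_mono) auto
  then show ?case using C[of t] 0 by simp
next
  case (Suc n)
  have "((\<lambda>s. - (C * s ^ n / fact n)) has_integral
      (- (C * t ^ Suc n / fact (Suc n)) - - (C * 0 ^ Suc n / fact (Suc n)))) {0..t}"
  proof (rule fundamental_theorem_of_calculus)
    have "((\<lambda>s. - (C / fact (Suc n)) * s ^ Suc n) has_real_derivative
        - (C / fact (Suc n)) * (real (Suc n) * s ^ (Suc n - Suc 0))) (at s within {0..t})" for s
      by (rule DERIV_cmult[OF DERIV_pow])
    moreover have "- (C / fact (Suc n)) * (real (Suc n) * s ^ (Suc n - Suc 0)) = - (C * s ^ n / fact n)" for s
      by (simp add: divide_simps del: of_nat_Suc)
    moreover have "- (C / fact (Suc n)) * s ^ Suc n = - (C * s ^ Suc n / fact (Suc n))" for s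
      by simp
    ultimately have "((\<lambda>s. - (C * s ^ Suc n / fact (Suc n))) has_real_derivative
        - (C * s ^ n / fact n)) (at s within {0..t})" for s
      by (simp only:)
    then show "((\<lambda>s. - (C * s ^ Suc n / fact (Suc n))) has_vector_derivative - (C * s ^ n / fact n)) (at s within {0..t})" for s
      by (simp add: has_real_derivative_iff_has_vector_derivative)
  qed (use Suc in simp)
  moreover have "((\<lambda>s. exp s * pairing s (Q g)) has_integral (exp t * pairing t g - pairing 0 g)) {0..t}"
    using Suc.prems by (intro exp_evolution) auto
  moreover have "- (C * s ^ n / fact n) \<le> exp s * pairing s (Q g)" if "s \<in> {0..t}" for s
    using that Suc.prems by (intro Suc.IH test_function_Q Q_nonneg Q_le_1) auto
  ultimately have "- (C * t ^ Suc n / fact (Suc n)) - - (C * 0 ^ Suc n / fact (Suc n))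
      \<le> exp t * pairing t g - pairing 0 g"
    by (rule has_integral_le)
  then show ?case using pairing_0_nonneg[OF Suc.prems(1,2)] by simp
qed

lemma pairing_nonneg_unit:
  assumes "test_function g" "\<And>x. 0 \<le> g x" "\<And>x. g x \<le> 1" "t \<ge> 0"
  shows "0 \<le> pairing t g"
proof -
  obtain C where C: "C \<ge> 0" "\<And>s. s \<in> {0..t} \<Longrightarrow> (\<integral>x. \<bar>u s x\<bar> \<partial>lebesgue) \<le> C"
    by (metis L1_norm_bounded)
  have "exp s * (\<integral>x. \<bar>u s x\<bar> \<partial>lebesgue) \<le> exp t * C" if "s \<in> {0..t}" for s
    using C that by (intro mult_mono) auto
  then have bound: "- (exp t * C * t ^ n / fact n) \<le> exp t * pairing t g" for n
    using assms by (intro pairing_lower_bound[of t]) auto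
  have "(\<lambda>n. inverse (fact n) * t ^ n) \<longlonglongrightarrow> 0"
    by (rule summable_LIMSEQ_zero[OF summable_exp])
  then have "(\<lambda>n. - (exp t * C) * (inverse (fact n) * t ^ n)) \<longlonglongrightarrow> - (exp t * C) * 0"
    by (rule tendsto_mult_left)
  then have "(\<lambda>n. - (exp t * C * t ^ n / fact n)) \<longlonglongrightarrow> 0"
    by (simp add: divide_inverse mult_ac)
  then have "0 \<le> exp t * pairing t g"
    by (rule LIMSEQ_le_const2) (use bound in auto)
  then show ?thesis by (metis exp_gt_zero mult_le_cancel_left_pos mult_zero_right)
qed

text \<open>
  Testing with the indicator of the set where \<open>u t\<close> is negative shows that this set is null.
\<close>

lemma u_nonneg:
  assumes t: "t \<ge> 0"
  shows "AE x in lebesgue. u t x \<ge> 0"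
proof -
  note ut = u_integrable[OF t]
  define A where "A = {x. u t x < 0}"
  have "{x \<in> space lebesgue. u t x < 0} \<in> sets lebesgue"
    using borel_measurable_integrable[OF ut] by (rule borel_measurable_less) simp
  then have A: "A \<in> sets lebesgue" by (simp add: A_def)
  have "0 \<le> pairing t (indicator A)"
    using t by (intro pairing_nonneg_unit test_function_indicator A) (auto simp: indicator_def)
  moreover have "max 0 (- u t x) = - (u t x * indicator A x)" for x
    by (auto simp: A_def indicator_def max_def)
  then have "(\<integral>x. max 0 (- u t x) \<partial>lebesgue) = - pairing t (indicator A)"
    by (simp add: pairing_def)
  moreover have "0 \<le> (\<integral>x. max 0 (- u t x) \<partial>lebesgue)" by (rule integral_nonneg_AE) simp
  ultimately have "(\<integral>x. max 0 (- u t x) \<partial>lebesgue) = 0" by simp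
  moreover have "integrable lebesgue (\<lambda>x. max 0 (- u t x))" using ut by simp
  ultimately have "AE x in lebesgue. max 0 (- u t x) = 0"
    using integral_nonneg_eq_0_iff_AE[of lebesgue "\<lambda>x. max 0 (- u t x)"] by simp
  then show ?thesis by eventually_elim (simp add: max_def split: if_split_asm)
qed

lemma pairing_mono:
  assumes t: "t \<ge> 0" and f: "test_function f" and g: "test_function g"
    and le: "AE x in lebesgue. f x \<le> g x"
  shows "pairing t f \<le> pairing t g"
  unfolding pairing_def
proof (rule integral_mono_AE)
  show "AE x in lebesgue. u t x * f x \<le> u t x * g x"
    using le u_nonneg[OF t] by eventually_elim (rule mult_left_mono)
  show "integrable lebesgue (\<lambda>x. u t x * f x)"
    by (rule integrable_mult_test[OF u_integrable[OF t] f])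
  show "integrable lebesgue (\<lambda>x. u t x * g x)"
    by (rule integrable_mult_test[OF u_integrable[OF t] g])
qed

end

section \<open>Occupation of balls\<close>

context symmetric_kernel
begin

text \<open>
  How a jump enlarges a ball. A point at distance less than \<open>r + \<eta>\<close> from the origin sees, within the
  range where \<open>J\<close> is bounded below, a ball of fixed radius inside \<open>ball 0 r\<close>. The gain \<open>\<eta>\<close> is the
  same for all \<open>r\<close>, which is what makes the iteration in \<open>finite_occupation_ball\<close> reach every radius.
\<close>

lemma conv_indicator_ball:
  assumes "J 0 > 0"
  obtains \<eta> where "\<eta> > 0"
    and "\<And>r. r > 0 \<Longrightarrow> \<exists>c>0. \<forall>x. c * indicator (ball 0 (r + \<eta>)) x \<le> conv J (indicator (ball 0 r)) x"
proof -
  have "isCont J 0" using cont by (simp add: continuous_on_eq_continuous_at)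
  then obtain \<delta> where "\<delta> > 0" and \<delta>: "\<And>z. dist z 0 < \<delta> \<Longrightarrow> dist (J z) (J 0) < J 0 / 2"
    using assms unfolding continuous_at_eps_delta by (metis half_gt_zero)
  have J_lower: "J 0 / 2 \<le> J z" if "norm z < \<delta>" for z
    using \<delta>[of z] that by (simp add: dist_real_def abs_real_def split: if_split_asm)
  have "\<exists>c>0. \<forall>x. c * indicator (ball 0 (r + \<delta> / 2)) x \<le> conv J (indicator (ball 0 r)) x"
    if "r > 0" for r
  proof -
    define \<rho> where "\<rho> = min r (\<delta> / 4)"
    have \<rho>: "0 < \<rho>" "\<rho> \<le> r" "\<delta> / 2 + 2 * \<rho> \<le> \<delta>"
      using \<open>r > 0\<close> \<open>\<delta> > 0\<close> by (auto simp: \<rho>_def min_def)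
    define V where "V = measure lebesgue (ball (0::'a) \<rho>)"
    have V: "measure lebesgue (ball z \<rho>) = V" for z :: 'a
      using \<rho> by (simp add: V_def content_ball)
    have "V > 0" using \<rho> by (simp add: V_def content_ball)
    have "J 0 / 2 * V * indicator (ball 0 (r + \<delta> / 2)) x \<le> conv J (indicator (ball 0 r)) x" for x
    proof (cases "x \<in> ball 0 (r + \<delta> / 2)")
      case False
      have "0 \<le> conv J (indicator (ball 0 r)) x"
        unfolding conv_def using nonneg by (intro integral_nonneg_AE) auto
      then show ?thesis using False by simp
    next
      case True
      then have x: "norm x < r + \<delta> / 2" by simp
      \<comment> \<open>Shrinking \<open>x\<close> by this factor gives the centre of a ball of radius \<open>\<rho>\<close> that lies in
        \<open>ball 0 r\<close> and within distance \<open>\<delta>\<close> of \<open>x\<close>.\<close>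
      define k where "k = (r - \<rho>) / (r + \<delta> / 2)"
      have pos: "r + \<delta> / 2 > 0" using \<open>r > 0\<close> \<open>\<delta> > 0\<close> by simp
      have k: "0 \<le> k" "k \<le> 1" using \<rho> pos \<open>\<delta> > 0\<close> by (auto simp: k_def)
      have k_mult: "k * (r + \<delta> / 2) = r - \<rho>" using pos by (simp add: k_def)
      have "norm (k *\<^sub>R x) = k * norm x" using k by simp
      also have "\<dots> \<le> k * (r + \<delta> / 2)" using x k by (intro mult_left_mono) auto
      also note k_mult
      finally have z1: "norm (k *\<^sub>R x) \<le> r - \<rho>" .
      have "x - k *\<^sub>R x = (1 - k) *\<^sub>R x" by (simp add: scaleR_left_diff_distrib)
      then have "norm (x - k *\<^sub>R x) = (1 - k) * norm x" using k by simp
      also have "\<dots> \<le> (1 - k) * (r + \<delta> / 2)" using x k by (intro mult_left_mono) auto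
      also have "\<dots> = \<delta> / 2 + \<rho>" unfolding left_diff_distrib k_mult by simp
      finally have z2: "norm (x - k *\<^sub>R x) \<le> \<delta> / 2 + \<rho>" .
      have "J 0 / 2 * V = (\<integral>y. J 0 / 2 * indicator (ball (k *\<^sub>R x) \<rho>) y \<partial>lebesgue)"
        by (simp add: V)
      also have "\<dots> \<le> conv J (indicator (ball 0 r)) x"
        unfolding conv_def
      proof (rule integral_mono)
        show "integrable lebesgue (\<lambda>y. J 0 / 2 * indicator (ball (k *\<^sub>R x) \<rho>) y)"
          using fmeasurableD2[OF lmeasurable_ball]
          by (intro integrable_mult_right integrable_real_indicator) (auto simp: less_top)
        show "integrable lebesgue (\<lambda>y. J (x - y) * indicator (ball 0 r) y)"
          by (intro integrable_conv_integrand test_function_indicator) simp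
        fix y
        show "J 0 / 2 * indicator (ball (k *\<^sub>R x) \<rho>) y \<le> J (x - y) * indicator (ball 0 r) y"
        proof (cases "y \<in> ball (k *\<^sub>R x) \<rho>")
          case True
          then have y: "norm (y - k *\<^sub>R x) < \<rho>" by (simp add: dist_norm norm_minus_commute)
          have "norm y \<le> norm (k *\<^sub>R x) + norm (y - k *\<^sub>R x)" by (rule norm_triangle_sub)
          then have "y \<in> ball 0 r" using z1 y by simp
          moreover have "norm (x - y) \<le> norm (x - k *\<^sub>R x) + norm (y - k *\<^sub>R x)"
            using norm_triangle_ineq4[of "x - k *\<^sub>R x" "y - k *\<^sub>R x"] by simp
          then have "norm (x - y) < \<delta>" using z2 y \<rho> by linarith
          ultimately show ?thesis using True J_lower by simp
        qed (simp add: nonneg)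
      qed
      finally show ?thesis using True by simp
    qed
    moreover have "J 0 / 2 * V > 0" using assms \<open>V > 0\<close> by simp
    ultimately show ?thesis by blast
  qed
  then show ?thesis using \<open>\<delta> > 0\<close> by (intro that[of "\<delta> / 2"]) auto
qed

end

context nonlocal_diffusion
begin

text \<open>
  For \<open>g\<close> the indicator of a set, the bounded integral is the total time that the mass spends in that
  set before it is absorbed.
\<close>

definition finite_occupation :: "('a \<Rightarrow> real) \<Rightarrow> bool" where
  "finite_occupation g \<longleftrightarrow> (\<exists>C. \<forall>T\<ge>0. integral {0..T} (\<lambda>s. pairing s g) \<le> C)"

lemma pairing_integrable_on:
  assumes "test_function g" "0 \<le> a"
  shows "(\<lambda>s. pairing s g) integrable_on {a..b}"
  using continuous_on_subset[OF continuous_on_pairing[OF assms(1)], of "{a..b}"] assms(2)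
  by (intro integrable_continuous_real) auto

lemma pairing_nonneg:
  assumes "t \<ge> 0" "test_function g" "\<And>x. 0 \<le> g x"
  shows "0 \<le> pairing t g"
  using pairing_mono[OF assms(1) test_function_const[of 0] assms(2)] assms(3)
  by (simp add: pairing_def)

lemma evolution_integral:
  assumes "test_function g" "0 \<le> a" "a \<le> b"
  shows "pairing b g - pairing a g =
    integral {a..b} (\<lambda>s. pairing s (Q g)) - integral {a..b} (\<lambda>s. pairing s g)"
  using integral_unique[OF evolution[OF assms]]
  by (simp add: Henstock_Kurzweil_Integration.integral_diff pairing_integrable_on assms test_function_Q)

lemma mass_le_initial:
  assumes "t \<ge> 0"
  shows "pairing t (\<lambda>x. 1) \<le> pairing 0 (\<lambda>x. 1)"
proof -
  have "integral {0..t} (\<lambda>s. pairing s (Q (\<lambda>x. 1))) \<le> integral {0..t} (\<lambda>s. pairing s (\<lambda>x. 1))"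
    by (intro integral_le pairing_integrable_on pairing_mono test_function_Q test_function_const)
       (auto intro: Q_le_1 test_function_const)
  then show ?thesis
    using evolution_integral[OF test_function_const[of 1], of 0 t] assms by simp
qed

lemma finite_occupation_dominated:
  assumes "test_function f" "test_function g" "c > 0" "\<And>x. c * f x \<le> g x" "finite_occupation g"
  shows "finite_occupation f"
proof -
  obtain C where C: "\<And>T. T \<ge> 0 \<Longrightarrow> integral {0..T} (\<lambda>s. pairing s g) \<le> C"
    using assms(5) by (auto simp: finite_occupation_def)
  have "integral {0..T} (\<lambda>s. pairing s f) \<le> C / c" if "T \<ge> 0" for T
  proof -
    have "c * integral {0..T} (\<lambda>s. pairing s f) = integral {0..T} (\<lambda>s. pairing s (\<lambda>x. c * f x))"
      by (simp add: pairing_cmult)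
    also have "\<dots> \<le> integral {0..T} (\<lambda>s. pairing s g)"
      using assms(1,2,4)
      by (intro integral_le pairing_integrable_on pairing_mono test_function_cmult) auto
    also have "\<dots> \<le> C" using C that by simp
    finally show ?thesis using \<open>c > 0\<close> by (simp add: field_simps)
  qed
  then show ?thesis by (auto simp: finite_occupation_def)
qed

lemma finite_occupation_add:
  assumes f: "test_function f" "finite_occupation f" and g: "test_function g" "finite_occupation g"
  shows "finite_occupation (\<lambda>x. f x + g x)"
proof -
  obtain C D where C: "\<And>T. T \<ge> 0 \<Longrightarrow> integral {0..T} (\<lambda>s. pairing s f) \<le> C"
    and D: "\<And>T. T \<ge> 0 \<Longrightarrow> integral {0..T} (\<lambda>s. pairing s g) \<le> D"
    using f g by (auto simp: finite_occupation_def)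
  have "integral {0..T} (\<lambda>s. pairing s (\<lambda>x. f x + g x)) \<le> C + D" if "T \<ge> 0" for T
  proof -
    have "integral {0..T} (\<lambda>s. pairing s (\<lambda>x. f x + g x)) =
        integral {0..T} (\<lambda>s. pairing s f + pairing s g)"
      using f g by (intro integral_cong) (simp add: pairing_add)
    also have "\<dots> = integral {0..T} (\<lambda>s. pairing s f) + integral {0..T} (\<lambda>s. pairing s g)"
      using f g by (intro Henstock_Kurzweil_Integration.integral_add pairing_integrable_on) auto
    also have "\<dots> \<le> C + D" using C[OF that] D[OF that] by simp
    finally show ?thesis .
  qed
  then show ?thesis by (auto simp: finite_occupation_def)
qed

text \<open>
  The mass balance: since \<open>Q 1 = 1 - J * 1\<^sub>H\<close>, the integral of \<open>\<langle>u, J * 1\<^sub>H\<rangle>\<close> up to time \<open>T\<close> is the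
  mass absorbed until \<open>T\<close>, which is at most the initial mass.
\<close>

lemma finite_occupation_conv_hole: "finite_occupation (conv J (indicator H))"
proof -
  have tests: "test_function (\<lambda>x. 1 :: real)" "test_function (indicator H)"
      "test_function (conv J (indicator H))"
    using H_measurable by (auto intro: test_function_intros test_function_conv)
  have "Q (\<lambda>x. 1) x + conv J (indicator H) x = 1" for x
  proof -
    have "Q (\<lambda>x. 1) x + conv J (indicator H) x = conv J (\<lambda>x. cut (\<lambda>x. 1) x + indicator H x) x"
      unfolding Q_def by (rule conv_add[symmetric]) (intro test_function_cut tests)+
    also have "(\<lambda>x. cut (\<lambda>x. 1) x + indicator H x) = (\<lambda>x. 1)"
      by (auto simp: cut_def indicator_def)
    finally show ?thesis by (simp add: conv_const)
  qed
  then have loss: "conv J (indicator H) = (\<lambda>x. 1 - Q (\<lambda>x. 1) x)"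
    by (auto simp: fun_eq_iff eq_diff_eq add.commute)
  have "integral {0..T} (\<lambda>s. pairing s (conv J (indicator H))) \<le> pairing 0 (\<lambda>x. 1)" if T: "T \<ge> 0" for T
  proof -
    have "integral {0..T} (\<lambda>s. pairing s (conv J (indicator H))) =
        integral {0..T} (\<lambda>s. pairing s (\<lambda>x. 1) - pairing s (Q (\<lambda>x. 1)))"
      unfolding loss
      by (intro integral_cong) (simp add: pairing_diff tests test_function_Q)
    also have "\<dots> = pairing 0 (\<lambda>x. 1) - pairing T (\<lambda>x. 1)"
      using evolution_integral[OF tests(1) order_refl T]
      by (simp add: Henstock_Kurzweil_Integration.integral_diff pairing_integrable_on tests test_function_Q)
    also have "\<dots> \<le> pairing 0 (\<lambda>x. 1)" using pairing_nonneg[OF T tests(1)] by simp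
    finally show ?thesis .
  qed
  then show ?thesis by (auto simp: finite_occupation_def)
qed

text \<open>
  Along the evolution of \<open>g\<close>, the integrals of \<open>\<langle>u, Q g\<rangle>\<close> and \<open>\<langle>u, g\<rangle>\<close> differ by the increment of
  \<open>\<langle>u, g\<rangle>\<close>, which the initial mass bounds.
\<close>

lemma finite_occupation_Q:
  assumes g: "test_function g" "\<And>x. 0 \<le> g x" "\<And>x. g x \<le> 1" "finite_occupation g"
  shows "finite_occupation (Q g)"
proof -
  obtain C where C: "\<And>T. T \<ge> 0 \<Longrightarrow> integral {0..T} (\<lambda>s. pairing s g) \<le> C"
    using g by (auto simp: finite_occupation_def)
  have "integral {0..T} (\<lambda>s. pairing s (Q g)) \<le> C + pairing 0 (\<lambda>x. 1)" if T: "T \<ge> 0" for T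
  proof -
    have "pairing T g \<le> pairing T (\<lambda>x. 1)"
      using g T by (intro pairing_mono test_function_const) auto
    then show ?thesis
      using evolution_integral[OF g(1) order_refl T] mass_le_initial[OF T]
        pairing_0_nonneg[OF g(1,2)] C[OF T]
      by simp
  qed
  then show ?thesis by (auto simp: finite_occupation_def)
qed

text \<open>
  The part of \<open>B\<close> inside the hole is invisible to \<open>Q\<close>; its contribution to the convolution is covered
  by the absorbed mass.
\<close>

lemma finite_occupation_conv_indicator:
  assumes B: "B \<in> sets lebesgue" and fin: "finite_occupation (indicator B)"
  shows "finite_occupation (conv J (indicator B))"
proof -
  note tests = test_function_indicator[OF B] test_function_indicator[OF H_measurable]
  have le: "1 * conv J (indicator B) x \<le> Q (indicator B) x + conv J (indicator H) x" for x
  proof -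
    have "conv J (indicator B) x \<le> conv J (\<lambda>x. cut (indicator B) x + indicator H x) x"
      by (intro conv_mono test_function_add test_function_cut tests) (auto simp: cut_def indicator_def)
    also have "\<dots> = Q (indicator B) x + conv J (indicator H) x"
      unfolding Q_def by (intro conv_add test_function_cut tests)
    finally show ?thesis by simp
  qed
  have fin_sum: "finite_occupation (\<lambda>x. Q (indicator B) x + conv J (indicator H) x)"
    by (intro finite_occupation_add finite_occupation_Q finite_occupation_conv_hole fin
        test_function_Q test_function_conv tests) (auto simp: indicator_def)
  have "test_function (\<lambda>x. Q (indicator B) x + conv J (indicator H) x)"
    by (intro test_function_add test_function_Q test_function_conv tests)
  from finite_occupation_dominated[OF test_function_conv[OF tests(1)] this zero_less_one le fin_sum]
  show ?thesis .
qed

lemma finite_occupation_ball: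
  assumes "J 0 > 0" and "r > 0" and "ball 0 r \<subseteq> H"
  shows "finite_occupation (indicator (ball 0 R))"
proof -
  obtain \<eta> where "\<eta> > 0" and spread: "\<And>r. r > 0 \<Longrightarrow>
      \<exists>c>0. \<forall>x. c * indicator (ball 0 (r + \<eta>)) x \<le> conv J (indicator (ball 0 r)) x"
    using conv_indicator_ball[OF assms(1)] by blast
  have test: "test_function (indicator (ball (0::'a) r'))" for r'
    by (intro test_function_indicator) simp
  have step: "finite_occupation (indicator (ball 0 (r' + \<eta>)))"
    if "r' > 0" "finite_occupation (conv J (indicator (ball 0 r')))" for r'
  proof -
    obtain c where c: "c > 0" "\<And>x. c * indicator (ball 0 (r' + \<eta>)) x \<le> conv J (indicator (ball 0 r')) x"
      using spread[OF \<open>r' > 0\<close>] by blast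
    show ?thesis
      by (rule finite_occupation_dominated[OF test test_function_conv[OF test] c that(2)])
  qed
  have grow: "finite_occupation (indicator (ball 0 (r + real (Suc n) * \<eta>)))" for n
  proof (induction n)
    case 0
    have "finite_occupation (conv J (indicator (ball 0 r)))"
    proof (rule finite_occupation_dominated[OF test_function_conv[OF test]
          test_function_conv[OF test_function_indicator[OF H_measurable]]
          zero_less_one _ finite_occupation_conv_hole])
      have "(indicator (ball 0 r) y :: real) \<le> indicator H y" for y :: 'a
        using assms(3) by (auto simp: indicator_def)
      then have "conv J (indicator (ball 0 r)) x \<le> conv J (indicator H) x" for x
        by (rule conv_mono[OF test test_function_indicator[OF H_measurable]])
      then show "1 * conv J (indicator (ball 0 r)) x \<le> conv J (indicator H) x" for x
        by (simp only: mult_1_left)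
    qed
    then show ?case using step \<open>r > 0\<close> by simp
  next
    case (Suc n)
    have "finite_occupation (indicator (ball 0 ((r + real (Suc n) * \<eta>) + \<eta>)))"
    proof (rule step)
      show "0 < r + real (Suc n) * \<eta>" using \<open>r > 0\<close> \<open>\<eta> > 0\<close> by (simp add: add_pos_nonneg)
      show "finite_occupation (conv J (indicator (ball 0 (r + real (Suc n) * \<eta>))))"
        by (intro finite_occupation_conv_indicator Suc.IH) simp
    qed
    then show ?case by (simp add: algebra_simps)
  qed
  obtain n where "R < real n * \<eta>" using reals_Archimedean3[OF \<open>\<eta> > 0\<close>] by blast
  moreover have "real (Suc n) * \<eta> = real n * \<eta> + \<eta>" by (simp add: algebra_simps)
  ultimately have "R \<le> r + real (Suc n) * \<eta>" using \<open>r > 0\<close> \<open>\<eta> > 0\<close> by linarith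
  then have sub: "ball (0::'a) R \<subseteq> ball 0 (r + real (Suc n) * \<eta>)" by (rule subset_ball)
  then have "1 * indicator (ball 0 R) x \<le> (indicator (ball 0 (r + real (Suc n) * \<eta>)) x :: real)" for x :: 'a
    unfolding mult_1_left indicator_def by (auto simp del: mem_ball)
  from finite_occupation_dominated[OF test test zero_less_one this grow[of n]]
  show ?thesis .
qed

section \<open>Decay in balls and convergence of the mass\<close>

text \<open>
  Because \<open>Q g \<ge> 0\<close>, the quantity \<open>\<langle>u, g\<rangle>\<close> falls between \<open>a\<close> and \<open>b \<le> a + 1\<close> by at most its integral
  over that unit interval; averaging over \<open>b\<close> gives the claim.
\<close>

lemma pairing_le_time_average:
  assumes g: "test_function g" "\<And>x. 0 \<le> g x" and a: "0 \<le> a"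
  shows "pairing a g \<le> 2 * integral {a..a + 1} (\<lambda>s. pairing s g)"
proof -
  define I where "I = integral {a..a + 1} (\<lambda>s. pairing s g)"
  have nonneg: "0 \<le> pairing s g" "0 \<le> pairing s (Q g)" if "s \<ge> a" for s
    using that a g by (auto intro!: pairing_nonneg test_function_Q Q_nonneg)
  have "pairing a g - I \<le> pairing b g" if b: "b \<in> {a..a + 1}" for b
  proof -
    have "0 \<le> integral {a..b} (\<lambda>s. pairing s (Q g))"
      using nonneg by (intro Henstock_Kurzweil_Integration.integral_nonneg pairing_integrable_on test_function_Q g a) auto
    moreover have "integral {a..b} (\<lambda>s. pairing s g) \<le> I"
      unfolding I_def using b nonneg
      by (intro integral_subset_le pairing_integrable_on g a) auto
    ultimately show ?thesis using evolution_integral[OF g(1) a, of b] b by simp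
  qed
  then have "integral {a..a + 1} (\<lambda>b. pairing a g - I) \<le> I"
    unfolding I_def by (intro integral_le pairing_integrable_on g a) auto
  then show ?thesis by (simp add: I_def)
qed

text \<open>
  The integral up to time \<open>T\<close> increases with \<open>T\<close> to a finite limit, so its increments over unit
  intervals vanish, and they control \<open>\<langle>u, g\<rangle>\<close>.
\<close>

lemma pairing_tendsto_0:
  assumes g: "test_function g" "\<And>x. 0 \<le> g x" "finite_occupation g"
  shows "((\<lambda>t. pairing t g) \<longlongrightarrow> 0) at_top"
proof (rule tendstoI)
  fix e :: real
  assume "e > 0"
  let ?\<Phi> = "\<lambda>T. integral {0..T} (\<lambda>s. pairing s g)"
  define S where "S = Sup (?\<Phi> ` {0..})"
  have bdd: "bdd_above (?\<Phi> ` {0..})"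
    using g(3) by (auto simp: finite_occupation_def bdd_above_def)
  have "\<exists>y\<in>?\<Phi> ` {0..}. S - e / 2 < y"
    using less_cSup_iff[OF _ bdd, of "S - e / 2"] \<open>e > 0\<close> by (simp add: S_def)
  then obtain T where T: "T \<ge> 0" "S - e / 2 < ?\<Phi> T" by auto
  have "dist (pairing t g) 0 < e" if t: "t \<ge> T" for t
  proof -
    have t0: "0 \<le> t" using T t by simp
    have "?\<Phi> T \<le> ?\<Phi> t"
      using t by (intro integral_subset_le pairing_integrable_on g) (auto intro!: pairing_nonneg g)
    moreover have "?\<Phi> (t + 1) \<le> S"
      unfolding S_def using t0 by (intro cSup_upper bdd) auto
    moreover have "?\<Phi> t + integral {t..t + 1} (\<lambda>s. pairing s g) = ?\<Phi> (t + 1)"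
      using t0 by (intro Henstock_Kurzweil_Integration.integral_combine pairing_integrable_on g) auto
    ultimately have "pairing t g < e"
      using pairing_le_time_average[OF g(1,2) t0] T(2) by linarith
    then show ?thesis using pairing_nonneg[OF t0 g(1,2)] by simp
  qed
  then show "\<forall>\<^sub>F t in at_top. dist (pairing t g) 0 < e"
    unfolding eventually_at_top_linorder by blast
qed

lemma pairing_cong_AE:
  assumes "t \<ge> 0" "test_function f" "test_function g" "AE x in lebesgue. f x = g x"
  shows "pairing t f = pairing t g"
proof (rule antisym)
  have "AE x in lebesgue. f x \<le> g x" "AE x in lebesgue. g x \<le> f x"
    using assms(4) by (eventually_elim, simp)+
  then show "pairing t f \<le> pairing t g" "pairing t g \<le> pairing t f"
    using assms by (auto intro: pairing_mono)
qed

lemma pairing_conserved: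
  assumes g: "test_function g" and stationary: "AE x in lebesgue. x \<in> - H \<longrightarrow> Q g x = g x" and t: "t \<ge> 0"
  shows "pairing t g = (\<integral>x. u0 x * g x \<partial>lebesgue)"
proof -
  have "AE x in lebesgue. cut (Q g) x = cut g x"
    using stationary by eventually_elim (auto simp: cut_def indicator_def)
  then have "pairing s (cut (Q g)) = pairing s (cut g)" if "s \<ge> 0" for s
    using that by (intro pairing_cong_AE test_function_cut test_function_Q g)
  then have "pairing s (Q g) = pairing s g" if "s \<ge> 0" for s
    using that by (simp add: pairing_cut g test_function_Q)
  then have "integral {0..t} (\<lambda>s. pairing s (Q g)) = integral {0..t} (\<lambda>s. pairing s g)"
    by (intro integral_cong) simp
  then show ?thesis
    using evolution_integral[OF g order_refl t] by (simp add: pairing_at_0 g)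
qed

text \<open>
  By conservation, the mass minus its claimed limit is \<open>\<langle>u(t), 1 - g\<rangle>\<close>. It is split at a radius
  beyond which \<open>1 - g\<close> is small: the outer part is controlled by the bounded mass, the inner part by
  the decay in the ball.
\<close>

lemma mass_tendsto:
  assumes J0: "J 0 > 0" and hole: "r > 0" "ball 0 r \<subseteq> H"
    and g: "test_function g" and stationary: "AE x in lebesgue. x \<in> - H \<longrightarrow> Q g x = g x"
    and limit: "\<And>\<epsilon>. \<epsilon> > 0 \<Longrightarrow> \<exists>R. AE x in lebesgue. R \<le> norm x \<longrightarrow> \<bar>g x - 1\<bar> < \<epsilon>"
  shows "((\<lambda>t. \<integral>x. u t x \<partial>lebesgue) \<longlongrightarrow> (\<integral>x. u0 x * g x \<partial>lebesgue)) at_top"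
proof (rule tendstoI)
  fix e :: real
  assume "e > 0"
  have one: "test_function (\<lambda>x. 1 :: real)" by (rule test_function_const)
  define M where "M = pairing 0 (\<lambda>x. 1)"
  have "M \<ge> 0" unfolding M_def by (intro pairing_0_nonneg one) simp
  \<comment> \<open>\<open>M + 1\<close> instead of \<open>M\<close>, since the initial mass may vanish\<close>
  define \<epsilon> where "\<epsilon> = e / (2 * (M + 1))"
  have "\<epsilon> > 0" using \<open>e > 0\<close> \<open>M \<ge> 0\<close> by (simp add: \<epsilon>_def)
  have "\<epsilon> * M \<le> e / 2" using \<open>e > 0\<close> \<open>M \<ge> 0\<close> by (simp add: \<epsilon>_def field_simps)
  obtain R where R: "AE x in lebesgue. R \<le> norm x \<longrightarrow> \<bar>g x - 1\<bar> < \<epsilon>"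
    using limit[OF \<open>\<epsilon> > 0\<close>] by blast
  have d: "test_function (\<lambda>x. 1 - g x)" by (intro test_function_diff one g)
  obtain C where C: "C > 0" "\<And>x. \<bar>1 - g x\<bar> \<le> C" using test_function_bound[OF d] by metis
  let ?B = "indicator (ball (0::'a) R) :: 'a \<Rightarrow> real"
  have B: "test_function ?B" by (intro test_function_indicator) simp
  define w where "w = (\<lambda>x. \<epsilon> * 1 + C * ?B x)"
  have w: "test_function w" unfolding w_def by (intro test_function_add test_function_cmult one B)
  have AE_w: "AE x in lebesgue. \<bar>1 - g x\<bar> \<le> w x"
    using R
  proof eventually_elim
    case (elim x)
    show ?case
    proof (cases "x \<in> ball 0 R")
      case True
      then show ?thesis using C(2)[of x] \<open>\<epsilon> > 0\<close> by (simp add: w_def)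
    next
      case False
      then show ?thesis using elim by (simp add: w_def)
    qed
  qed
  have "((\<lambda>t. pairing t ?B) \<longlongrightarrow> 0) at_top"
    by (intro pairing_tendsto_0 B finite_occupation_ball[OF J0 hole]) simp
  moreover have "e / (2 * C) > 0" using \<open>e > 0\<close> C by simp
  ultimately have "\<forall>\<^sub>F t in at_top. pairing t ?B < e / (2 * C)"
    by (rule order_tendstoD)
  then show "\<forall>\<^sub>F t in at_top. dist (\<integral>x. u t x \<partial>lebesgue) (\<integral>x. u0 x * g x \<partial>lebesgue) < e"
    using eventually_ge_at_top[of "0::real"]
  proof eventually_elim
    case (elim t)
    have "(\<integral>x. u t x \<partial>lebesgue) - (\<integral>x. u0 x * g x \<partial>lebesgue) = pairing t (\<lambda>x. 1) - pairing t g"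
      using pairing_conserved[OF g stationary elim(2)] by (simp add: pairing_def)
    also have "\<dots> = pairing t (\<lambda>x. 1 - g x)"
      by (rule pairing_diff[OF elim(2) one g, symmetric])
    finally have eq: "(\<integral>x. u t x \<partial>lebesgue) - (\<integral>x. u0 x * g x \<partial>lebesgue) = pairing t (\<lambda>x. 1 - g x)" .
    have AE_lower: "AE x in lebesgue. - w x \<le> 1 - g x" and AE_upper: "AE x in lebesgue. 1 - g x \<le> w x"
      using AE_w by (eventually_elim, simp)+
    have neg: "test_function (\<lambda>x. - w x)" using test_function_cmult[OF w, of "-1"] by simp
    have "pairing t (\<lambda>x. - w x) \<le> pairing t (\<lambda>x. 1 - g x)" "pairing t (\<lambda>x. 1 - g x) \<le> pairing t w"
      by (intro pairing_mono elim w d neg AE_lower AE_upper)+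
    moreover have "pairing t (\<lambda>x. - w x) = - pairing t w" by (simp add: pairing_def)
    moreover have "pairing t w = \<epsilon> * pairing t (\<lambda>x. 1) + C * pairing t ?B"
      unfolding w_def pairing_add[OF elim(2) test_function_cmult[OF one] test_function_cmult[OF B]]
      by (simp only: pairing_cmult)
    moreover have "\<epsilon> * pairing t (\<lambda>x. 1) \<le> \<epsilon> * M"
      unfolding M_def using \<open>\<epsilon> > 0\<close> mass_le_initial[OF elim(2)] by simp
    moreover have "C * pairing t ?B < e / 2" using elim C by (simp add: field_simps)
    ultimately show ?case
      unfolding dist_real_def eq using \<open>\<epsilon> * M \<le> e / 2\<close> by (simp add: abs_less_iff)
  qed
qed

end

section \<open>The stationary solution\<close>

lemma symmetric_kernel_dispersal_kernel:
  assumes "dispersal_kernel J"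
  shows "symmetric_kernel J"
proof
  show "J x \<ge> 0" for x using assms unfolding dispersal_kernel_def by blast
  have "Ck_on 0 UNIV J" using assms unfolding dispersal_kernel_def smooth_on_def by blast
  then show "continuous_on UNIV J" by simp
  show "J (- x) = J x" for x
    using assms norm_minus_cancel[of x] unfolding dispersal_kernel_def by blast
  show "(\<integral>x. J x \<partial>lebesgue) = 1" using assms unfolding dispersal_kernel_def by blast
qed

lemma dispersal_kernel_support:
  assumes "dispersal_kernel J" "norm x > 1"
  shows "J x = 0"
proof -
  have "closure {x. J x \<noteq> 0} \<subseteq> cball 0 1" using assms(1) unfolding dispersal_kernel_def by blast
  then have "{x. J x \<noteq> 0} \<subseteq> cball 0 1" by (rule order_trans[OF closure_subset])
  then have "J x \<noteq> 0 \<Longrightarrow> x \<in> cball 0 1" by blast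
  then show ?thesis using assms(2) by auto
qed

lemma dispersal_kernel_bounded:
  fixes J :: "'a::euclidean_space \<Rightarrow> real"
  assumes J: "dispersal_kernel J"
  obtains K where "K \<ge> 0" "\<And>x. J x \<le> K"
proof -
  interpret symmetric_kernel J by (rule symmetric_kernel_dispersal_kernel[OF J])
  have "compact (J ` cball 0 1)"
    using cont by (intro compact_continuous_image continuous_on_subset[OF cont]) auto
  from compact_imp_bounded[OF this] obtain K where "\<forall>y\<in>J ` cball 0 1. norm y \<le> K"
    unfolding bounded_iff by blast
  then have K: "\<bar>J x\<bar> \<le> K" if "norm x \<le> 1" for x
    using that by simp
  have "J x \<le> max K 0" for x
    using K[of x] dispersal_kernel_support[OF J, of x] by (cases "norm x \<le> 1") auto
  then show ?thesis using that[of "max K 0"] by simp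
qed

lemma stationary_limit:
  assumes "stationary_solution J H \<phi>" "\<epsilon> > 0"
  obtains R where "AE x in lebesgue. R \<le> norm x \<longrightarrow> \<bar>\<phi> x - 1\<bar> < \<epsilon>"
proof -
  have "(\<phi> \<longlongrightarrow> 1) (inf at_infinity (ae_filter lebesgue))"
    using assms(1) by (simp add: stationary_solution_def)
  from tendstoD[OF this assms(2)]
  obtain P P' where P: "eventually P at_infinity" and P': "eventually P' (ae_filter lebesgue)"
    and imp: "\<And>x. P x \<Longrightarrow> P' x \<Longrightarrow> dist (\<phi> x) 1 < \<epsilon>"
    unfolding eventually_inf by blast
  obtain R where R: "\<And>x. R \<le> norm x \<Longrightarrow> P x" using P unfolding eventually_at_infinity by blast
  have "AE x in lebesgue. R \<le> norm x \<longrightarrow> \<bar>\<phi> x - 1\<bar> < \<epsilon>"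
    using P' by eventually_elim (use R imp in \<open>simp add: dist_real_def\<close>)
  then show ?thesis by (rule that)
qed

lemma stationary_measurable:
  fixes \<phi> :: "'a::euclidean_space \<Rightarrow> real"
  assumes "stationary_solution J H \<phi>"
  shows "\<phi> \<in> borel_measurable lebesgue"
proof (rule borel_measurable_LIMSEQ_real)
  show "(\<lambda>n. indicator (cball 0 (real n)) x * \<phi> x) \<longlonglongrightarrow> \<phi> x" for x
  proof (rule tendsto_eventually)
    obtain N where "norm x \<le> real N" using real_arch_simple by blast
    then show "\<forall>\<^sub>F n in sequentially. indicator (cball 0 (real n)) x * \<phi> x = \<phi> x"
      unfolding eventually_sequentially by (intro exI[of _ N]) (auto simp: indicator_def)
  qed
  have "\<phi> absolutely_integrable_on cball 0 (real n)" for n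
    using assms by (simp add: stationary_solution_def)
  then show "(\<lambda>x. indicator (cball 0 (real n)) x * \<phi> x) \<in> borel_measurable lebesgue" for n
    by (auto simp: set_integrable_def dest: borel_measurable_integrable)
qed

text \<open>
  Far away \<open>\<phi>\<close> is close to \<open>1\<close>. On a bounded part of the complement of \<open>H\<close>, the equation \<open>\<phi> = J * \<phi>\<close>
  and the unit range of \<open>J\<close> bound \<open>\<phi>\<close> by its integral over a slightly larger ball.
\<close>

lemma stationary_bounded:
  fixes \<phi> :: "'a::euclidean_space \<Rightarrow> real"
  assumes J: "dispersal_kernel J" and \<phi>: "stationary_solution J H \<phi>"
  obtains C where "AE x in lebesgue. \<bar>\<phi> x\<bar> \<le> C"
proof -
  interpret symmetric_kernel J by (rule symmetric_kernel_dispersal_kernel[OF J])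
  obtain K where K: "K \<ge> 0" "\<And>x. J x \<le> K" using dispersal_kernel_bounded[OF J] by metis
  obtain R where R: "AE x in lebesgue. R \<le> norm x \<longrightarrow> \<bar>\<phi> x - 1\<bar> < 1"
    by (rule stationary_limit[OF \<phi> zero_less_one])
  let ?B = "cball (0::'a) (R + 1)"
  have "\<phi> absolutely_integrable_on ?B" using \<phi> by (simp add: stationary_solution_def)
  then have int: "integrable lebesgue (\<lambda>y. indicator ?B y * \<phi> y)" by (simp add: set_integrable_def)
  define D where "D = (\<integral>y. K * \<bar>indicator ?B y * \<phi> y\<bar> \<partial>lebesgue)"
  have conv_bound: "\<bar>conv J \<phi> x\<bar> \<le> D" if "norm x < R" for x
    unfolding conv_def D_def
  proof (rule integral_abs_bound_integral)
    have pointwise: "\<bar>J (x - y) * \<phi> y\<bar> \<le> K * \<bar>indicator ?B y * \<phi> y\<bar>" for y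
    proof (cases "y \<in> ?B")
      case True
      then show ?thesis using K(2)[of "x - y"] nonneg[of "x - y"] by (simp add: abs_mult mult_right_mono)
    next
      case False
      then have "norm (x - y) > 1"
        using that norm_triangle_ineq2[of y x] by (simp add: norm_minus_commute)
      then show ?thesis using dispersal_kernel_support[OF J] K(1) by simp
    qed
    then show "\<bar>J (x - y) * \<phi> y\<bar> \<le> K * \<bar>indicator ?B y * \<phi> y\<bar>" for y .
    show bound_int: "integrable lebesgue (\<lambda>y. K * \<bar>indicator ?B y * \<phi> y\<bar>)"
      by (intro integrable_mult_right integrable_abs int)
    show "integrable lebesgue (\<lambda>y. J (x - y) * \<phi> y)"
    proof (rule Bochner_Integration.integrable_bound[OF bound_int])
      show "(\<lambda>y. J (x - y) * \<phi> y) \<in> borel_measurable lebesgue"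
        by (intro borel_measurable_times stationary_measurable[OF \<phi>]
            borel_measurable_integrable[OF integrable_translate(2)])
      show "AE y in lebesgue. norm (J (x - y) * \<phi> y) \<le> norm (K * \<bar>indicator ?B y * \<phi> y\<bar>)"
        using pointwise K(1) by (simp add: abs_mult)
    qed
  qed
  have "AE x in lebesgue. x \<in> - H \<longrightarrow> conv J \<phi> x = \<phi> x" "AE x in lebesgue. x \<in> H \<longrightarrow> \<phi> x = 0"
    using \<phi> by (auto simp: stationary_solution_def)
  then have "AE x in lebesgue. \<bar>\<phi> x\<bar> \<le> max 2 D"
    using R
  proof eventually_elim
    case (elim x)
    show ?case
    proof (cases "R \<le> norm x \<or> x \<in> H")
      case True
      then show ?thesis using elim by auto
    next
      case False
      then show ?thesis using elim conv_bound[of x] by auto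
    qed
  qed
  then show ?thesis by (rule that)
qed

section \<open>Asymptotic mass\<close>

theorem proposition4p2:
  fixes H :: "(real ^ 'n) set"
    and J u0 \<phi> :: "real ^ 'n \<Rightarrow> real"
    and u :: "real \<Rightarrow> real ^ 'n \<Rightarrow> real"
  assumes dim: "CARD('n) \<ge> 3"
    and H: "bounded H" "open H" "smooth_boundary H" "0 \<in> H"
    and J: "dispersal_kernel J"
    and u0_nonneg: "AE x in lebesgue. u0 x \<ge> 0"
    and u0_L1: "integrable lebesgue u0"
    and u0_Linfty: "\<exists>C. AE x in lebesgue. \<bar>u0 x\<bar> \<le> C"
    and u0_zero: "AE x in lebesgue. x \<in> H \<longrightarrow> u0 x = 0"
    and u: "nonlocal_solution J H u0 u"
    and \<phi>: "stationary_solution J H \<phi>"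
  shows "((\<lambda>t. \<integral>x. u t x \<partial>lebesgue) \<longlongrightarrow> (\<integral>x. u0 x * \<phi> x \<partial>lebesgue)) at_top"
proof -
  have H_sets: "H \<in> sets lebesgue" using \<open>open H\<close> by simp
  interpret symmetric_kernel J by (rule symmetric_kernel_dispersal_kernel[OF J])
  interpret nonlocal_diffusion J H u0 u
    by unfold_locales (fact H_sets u0_L1 u0_nonneg u0_zero u)+
  have J0: "J 0 > 0" using J unfolding dispersal_kernel_def by blast
  obtain r where r: "r > 0" "ball 0 r \<subseteq> H" using \<open>open H\<close> \<open>0 \<in> H\<close> open_contains_ball by blast
  note [measurable] = stationary_measurable[OF \<phi>]
  obtain C where C: "AE x in lebesgue. \<bar>\<phi> x\<bar> \<le> C" by (rule stationary_bounded[OF J \<phi>])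
  \<comment> \<open>A version of \<open>\<phi>\<close> that is bounded everywhere, so that it is a test function.\<close>
  define \<psi> where "\<psi> x = max (- \<bar>C\<bar>) (min \<bar>C\<bar> (\<phi> x))" for x
  have \<psi>_test: "test_function \<psi>"
    unfolding \<psi>_def by (rule test_functionI[of _ "\<bar>C\<bar>"]) auto
  have \<psi>_eq: "AE x in lebesgue. \<psi> x = \<phi> x"
    using C by eventually_elim (auto simp: \<psi>_def)
  have "AE x in lebesgue. x \<in> H \<longrightarrow> \<phi> x = 0" using \<phi> by (simp add: stationary_solution_def)
  with \<psi>_eq have cut_eq: "AE x in lebesgue. cut \<psi> x = \<phi> x"
    by eventually_elim (auto simp: cut_def indicator_def)
  have "Q \<psi> x = conv J \<phi> x" for x
    unfolding Q_def conv_def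
  proof (rule integral_cong_AE)
    note J_meas = borel_measurable_integrable[OF integrable_translate(2)]
    show "(\<lambda>y. J (x - y) * cut \<psi> y) \<in> borel_measurable lebesgue"
      by (intro borel_measurable_times J_meas test_function_measurable test_function_cut \<psi>_test)
    show "(\<lambda>y. J (x - y) * \<phi> y) \<in> borel_measurable lebesgue"
      by (intro borel_measurable_times J_meas stationary_measurable[OF \<phi>])
    show "AE y in lebesgue. J (x - y) * cut \<psi> y = J (x - y) * \<phi> y"
      using cut_eq by eventually_elim simp
  qed
  moreover have "AE x in lebesgue. x \<in> - H \<longrightarrow> conv J \<phi> x = \<phi> x"
    using \<phi> by (simp add: stationary_solution_def)
  ultimately have stationary: "AE x in lebesgue. x \<in> - H \<longrightarrow> Q \<psi> x = \<psi> x"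
    using \<psi>_eq by (auto elim: eventually_elim2)
  have "\<exists>R. AE x in lebesgue. R \<le> norm x \<longrightarrow> \<bar>\<psi> x - 1\<bar> < \<epsilon>" if pos: "\<epsilon> > 0" for \<epsilon>
  proof -
    obtain R where R: "AE x in lebesgue. R \<le> norm x \<longrightarrow> \<bar>\<phi> x - 1\<bar> < \<epsilon>"
      by (rule stationary_limit[OF \<phi> pos])
    have "AE x in lebesgue. R \<le> norm x \<longrightarrow> \<bar>\<psi> x - 1\<bar> < \<epsilon>"
      using R \<psi>_eq by eventually_elim simp
    then show ?thesis by blast
  qed
  from mass_tendsto[OF J0 r \<psi>_test stationary this]
  have "((\<lambda>t. \<integral>x. u t x \<partial>lebesgue) \<longlongrightarrow> (\<integral>x. u0 x * \<psi> x \<partial>lebesgue)) at_top" .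
  moreover have "(\<integral>x. u0 x * \<psi> x \<partial>lebesgue) = (\<integral>x. u0 x * \<phi> x \<partial>lebesgue)"
  proof (rule integral_cong_AE)
    show "AE x in lebesgue. u0 x * \<psi> x = u0 x * \<phi> x"
      using \<psi>_eq by eventually_elim simp
  qed (use u0_L1 stationary_measurable[OF \<phi>] test_function_measurable[OF \<psi>_test] in auto)
  ultimately show ?thesis by simp
qed

end
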